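(* Let $\Omega\subset\mathbb{R}^d$, $d\ge2$, be a domain and $T>0$. For $\alpha>0$ and $3\le r,q\le\infty$ set $$s=\min\left(d\,\frac{r-2}{r}-\alpha\frac2q,\ d\,\frac{r-3}{r}-1+\alpha\frac{q-3}{q}\right).$$ Assume $s\ge0$ and that $u\in L^q_{\rm loc}(0,T;L^r_{\rm loc}(\Omega))$, $p\in L^{q/2}_{\rm loc}(0,T;L^{r/2}_{\rm loc}(\Omega))$ is a weak solution of the incompressible Euler equations having non-negative local anomalous dissipation measure $\varepsilon[u]\in\mathcal{M}_{\rm loc}(\Omega\times(0,T))$. Then: (i) If $q<\infty$, then for every Borel set $B\subset\subset\Omega\times(0,T)$, $$\mathcal{H}^s_\alpha(B)<\infty\ \Rightarrow\ \varepsilon[u](B)=0,$$ with the convention that $s=\min\left(d-\alpha\frac2q,\ d-1+\alpha\frac{q-3}{q}\right)$ whenever $r=\infty$. (ii) If $q=\infty$, then $\varepsilon[u]\ll\mathcal{H}^s_\alpha$ for $s=\min\left(d\,\frac{r-2}{r},\ d\,\frac{r-3}{r}-1+\alpha\right)$, with the convention that $s=\min(d,\ d-1+\alpha)$ whenever $r=\infty$. In particular, if $\varepsilon[u]\not\equiv0$ is concentrated on a space-time set $S$, then $\dim_{\mathcal{H}_\alpha}S\ge s$. Further, if $\Omega$ is bounded and $(u,p)\in L^q(0,T;L^r(\Omega))\times L^{q/2}(0,T;L^{r/2}(\Omega))$ has a positive boundary extendable dissipation $\overline\varepsilon[u]\in\mathcal{M}_{\rm loc}(\overline\Omega\times(0,T])$,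 then the same conclusions (i) and (ii) hold for $\overline\varepsilon[u]$, where in (i) every Borel set $B\subset\subset\overline\Omega\times(0,T]$ is allowed.
   Context: $\mathcal{M}_{\rm loc}(X)$ denotes locally finite Borel (Radon) measures on $X$; $B\subset\subset X$ means that the closure of $B$ is compact and contained in $X$. The domain $\Omega$ possibly has smooth boundary. Euler equations: $\partial_t u+(u\cdot\nabla)u=-\nabla p$, $\operatorname{div}u=0$ in $\Omega\times(0,T)$, $u\cdot n=0$ on $\partial\Omega\times(0,T)$ ($n$ the outward unit normal). A weak solution satisfies the first two equations in the sense of distributions, i.e. $\int_0^T\int_\Omega (u\cdot\partial_t\phi+u\otimes u:\nabla\phi+p\operatorname{div}\phi)\,dx\,dt=0$ for all $\phi\in C_c^\infty(\Omega\times(0,T);\mathbb{R}^d)$ and $\operatorname{div}u=0$ distributionally; the boundary condition is meant in the weak sense (when $u$ is integrable up to the boundary: $\int_0^T\int_\Omega u\cdot\nabla\varphi\,dx\,dt=0$ for all $\varphi\in C^1_c(\overline\Omega\times(0,T))$). Anomalous dissipation: $\varepsilon[u]:=-\partial_t\frac{|u|^2}{2}-\operatorname{div}\big(\big(\frac{|u|^2}{2}+p\big)u\big)$ in the sense of distributions on $\Omega\times(0,T)$; saying that it is a non-negative local measure means that for some positive $\varepsilon[u]\in\mathcal{M}_{\rm loc}(\Omega\times(0,T))$, $\int_0^T\int_\Omega\big[\frac{|u|^2}{2}\partial_t\varphi+\big(\frac{|u|^2}{2}+p\big)u\cdot\nabla\varphi\big]dx\,dt=\int\varphi\,d\varepsilon[u]$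 for all $\varphi\in C^1_c(\Omega\times(0,T))$. Boundary extendable dissipation: for $\Omega$ bounded and a solution $u\in L^3(\Omega\times(0,T))$, $p\in L^{3/2}(\Omega\times(0,T))$ of the Euler system, $u$ has a positive boundary extendable dissipation if there is a positive measure $\overline\varepsilon[u]\in\mathcal{M}_{\rm loc}(\overline\Omega\times(0,T])$ such that $\int_0^T\int_\Omega\big[\frac{|u|^2}{2}\partial_t\varphi+\big(\frac{|u|^2}{2}+p\big)u\cdot\nabla\varphi\big]dx\,dt=\int_{\overline\Omega\times(0,T]}\varphi\,d\overline\varepsilon[u]$ for all $\varphi\in C^1_c(\overline\Omega\times(0,T])$. Anisotropic Hausdorff measure: for $\alpha\ge0$, $\delta>0$, let $\mathcal{C}^\alpha_\delta(x,t)=B_\delta(x)\times(t-\delta^\alpha,t+\delta^\alpha)\subset\mathbb{R}^d\times\mathbb{R}$. For $s\ge0$, $\mathcal{H}^s_\alpha$ is the measure obtained by Carathéodory's construction from the family of all such cylinders with gauge $\Psi^s(\mathcal{C}^\alpha_\delta(x,t))=\delta^s$, i.e. $\mathcal{H}^s_\alpha(A)=\lim_{\rho\to0^+}\inf\{\sum_i r_i^s\}$, the infimum over at most countable covers $\{\mathcal{C}^\alpha_{r_i}(x_i,t_i)\}_i$ of $A$ by cylinders of diameter $\le\rho$. For a Borel set $A$, $\dim_{\mathcal{H}_\alpha}(A)=\inf\{s\ge0:\mathcal{H}^s_\alpha(A)=0\}$. A measure $\mu$ is concentrated on a (Borel) set $S$ if $\mu(A)=\mu(A\cap S)$ for all measurable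 $A$. $\mu\ll\mathcal{H}^s_\alpha$ means $\mathcal{H}^s_\alpha(A)=0\Rightarrow\mu(A)=0$ for Borel sets $A$ in the space where $\mu$ is defined. *)

theory Defs
  imports "HOL-Analysis.Analysis" "HOL-Probability.Essential_Supremum"
begin

text \<open>
  Space-time points are pairs \<open>(x, t)\<close> of type \<open>'a \<times> real\<close>, where the euclidean space \<open>'a\<close> plays
  the role of \<open>\<real>\<^sup>d\<close> with \<open>d = DIM('a)\<close>.  Integrability exponents range over \<^typ>\<open>ennreal\<close>.
\<close>

text \<open>Powers with a positive exponent, with \<open>\<infinity>\<close> raised to \<open>e\<close> being \<open>\<infinity>\<close>.\<close>

definition ennreal_powr :: "ennreal \<Rightarrow> real \<Rightarrow> ennreal" where
  "ennreal_powr a e = (if a = \<infinity> then \<infinity> else ennreal (enn2real a powr e))"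

definition Lnorm :: "ennreal \<Rightarrow> 'b measure \<Rightarrow> ('b \<Rightarrow> ennreal) \<Rightarrow> ennreal" where
  "Lnorm r M f =
     (if r = \<infinity> then esssup M f
      else ennreal_powr (\<integral>\<^sup>+x. ennreal_powr (f x) (enn2real r) \<partial>M) (1 / enn2real r))"

definition in_L ::
  "ennreal \<Rightarrow> 'b::euclidean_space set \<Rightarrow> ('b \<Rightarrow> 'c::real_normed_vector) \<Rightarrow> bool" where
  "in_L r X f \<longleftrightarrow>
     f \<in> borel_measurable (restrict_space lborel X) \<and>
     Lnorm r (restrict_space lborel X) (\<lambda>z. ennreal (norm (f z))) < \<infinity>"

text \<open>
  \<open>in_LL q r I U f\<close> is \<open>f \<in> L\<^sup>q(I; L\<^sup>r(U))\<close>, read as finiteness of the mixed norm of a jointly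
  measurable representative (which for \<open>r = \<infinity>\<close> asks less than strong measurability of
  \<open>t \<mapsto> f(\<cdot>, t)\<close> in \<open>L\<^sup>\<infinity>(U)\<close>).
\<close>

definition in_LL ::
  "ennreal \<Rightarrow> ennreal \<Rightarrow> real set \<Rightarrow> 'a::euclidean_space set \<Rightarrow>
     ('a \<times> real \<Rightarrow> 'c::real_normed_vector) \<Rightarrow> bool" where
  "in_LL q r I U f \<longleftrightarrow>
     f \<in> borel_measurable (restrict_space lborel (U \<times> I)) \<and>
     Lnorm q (restrict_space lborel I)
       (\<lambda>t. Lnorm r (restrict_space lborel U) (\<lambda>x. ennreal (norm (f (x, t))))) < \<infinity>"

definition in_LL_loc ::
  "ennreal \<Rightarrow> ennreal \<Rightarrow> real set \<Rightarrow> 'a::euclidean_space set \<Rightarrow>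
     ('a \<times> real \<Rightarrow> 'c::real_normed_vector) \<Rightarrow> bool" where
  "in_LL_loc q r I U f \<longleftrightarrow>
     f \<in> borel_measurable (restrict_space lborel (U \<times> I)) \<and>
     (\<forall>J K. compact J \<and> J \<subseteq> I \<and> compact K \<and> K \<subseteq> U \<longrightarrow> in_LL q r J K f)"

primrec Ck :: "nat \<Rightarrow> ('b::euclidean_space \<Rightarrow> 'c::real_normed_vector) \<Rightarrow> bool" where
  "Ck 0 f \<longleftrightarrow> continuous_on UNIV f"
| "Ck (Suc k) f \<longleftrightarrow>
     (\<forall>z. f differentiable (at z)) \<and>
     (\<forall>b\<in>Basis. Ck k (\<lambda>z. frechet_derivative f (at z) b))"

definition compactly_in :: "'b::topological_space set \<Rightarrow> 'b set \<Rightarrow> bool" where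
  "compactly_in B X \<longleftrightarrow> compact (closure B) \<and> closure B \<subseteq> X"

text \<open>
  \<open>C\<^sup>k\<^sub>c(X)\<close> consists of the restrictions to \<open>X\<close> of \<open>C\<^sup>k\<close> functions on the whole space whose support
  within \<open>X\<close> is a compact subset of \<open>X\<close>.  For open \<open>X\<close> extension by zero shows that this is
  the usual space.  For \<open>X\<close> such as \<open>closure \<Omega> \<times> {0<..T}\<close> it fixes the meaning of being
  differentiable up to the boundary; nothing is required of a test function at the ends of \<open>X\<close>
  that belong to \<open>X\<close>.
\<close>

definition Ckc :: "nat \<Rightarrow> 'b::euclidean_space set \<Rightarrow> ('b \<Rightarrow> 'c::real_normed_vector) set" where
  "Ckc k X = {f. Ck k f \<and> compactly_in {z \<in> X. f z \<noteq> 0} X}"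

definition smooth_c :: "'b::euclidean_space set \<Rightarrow> ('b \<Rightarrow> 'c::real_normed_vector) set" where
  "smooth_c X = (\<Inter>k. Ckc k X)"

definition dt :: "('a::euclidean_space \<times> real \<Rightarrow> 'c::real_normed_vector) \<Rightarrow> 'a \<times> real \<Rightarrow> 'c" where
  "dt f z = frechet_derivative f (at z) (0, 1)"

definition dx ::
  "'a \<Rightarrow> ('a::euclidean_space \<times> real \<Rightarrow> 'c::real_normed_vector) \<Rightarrow> 'a \<times> real \<Rightarrow> 'c" where
  "dx v f z = frechet_derivative f (at z) (v, 0)"

definition grad_x :: "('a::euclidean_space \<times> real \<Rightarrow> real) \<Rightarrow> 'a \<times> real \<Rightarrow> 'a" where
  "grad_x f z = (\<Sum>i\<in>Basis. dx i f z *\<^sub>R i)"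

definition div_x :: "('a::euclidean_space \<times> real \<Rightarrow> 'a) \<Rightarrow> 'a \<times> real \<Rightarrow> real" where
  "div_x f z = (\<Sum>i\<in>Basis. dx i f z \<bullet> i)"

text \<open>
  The last conjunct is the weak form of \<open>u \<cdot> n = 0\<close> on the boundary, imposed whenever \<open>u\<close> is
  integrable up to the boundary; otherwise the boundary condition has no meaning.
\<close>

definition weak_euler ::
  "'a::euclidean_space set \<Rightarrow> real \<Rightarrow> ('a \<times> real \<Rightarrow> 'a) \<Rightarrow> ('a \<times> real \<Rightarrow> real) \<Rightarrow> bool" where
  "weak_euler \<Omega> T u p \<longleftrightarrow>
     (\<forall>K. compact K \<and> K \<subseteq> \<Omega> \<times> {0<..<T} \<longrightarrow> in_L 2 K u \<and> in_L 1 K p) \<and>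
     (\<forall>\<phi>\<in>smooth_c (\<Omega> \<times> {0<..<T}).
        (LINT z:\<Omega> \<times> {0<..<T}|lborel.
           u z \<bullet> dt \<phi> z
           + (\<Sum>i\<in>Basis. \<Sum>j\<in>Basis. (u z \<bullet> i) * (u z \<bullet> j) * (dx j \<phi> z \<bullet> i))
           + p z * div_x \<phi> z) = 0) \<and>
     (\<forall>\<psi>\<in>smooth_c (\<Omega> \<times> {0<..<T}).
        (LINT z:\<Omega> \<times> {0<..<T}|lborel. u z \<bullet> grad_x \<psi> z) = 0) \<and>
     ((\<forall>K. compact K \<and> K \<subseteq> closure \<Omega> \<times> {0<..<T} \<longrightarrow> in_L 1 (K \<inter> \<Omega> \<times> {0<..<T}) u) \<longrightarrow>
      (\<forall>\<psi>\<in>Ckc 1 (closure \<Omega> \<times> {0<..<T}).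
         (LINT z:\<Omega> \<times> {0<..<T}|lborel. u z \<bullet> grad_x \<psi> z) = 0))"

text \<open>
  \<open>\<M>\<^sub>l\<^sub>o\<^sub>c(X)\<close> (positive part).  All sets \<open>X\<close> used below are locally compact, so that finiteness on
  compact sets is the same as local finiteness.
\<close>

definition radon_measure_on :: "'b::topological_space set \<Rightarrow> 'b measure \<Rightarrow> bool" where
  "radon_measure_on X \<mu> \<longleftrightarrow>
     sets \<mu> = sets (restrict_space borel X) \<and>
     (\<forall>K. compact K \<and> K \<subseteq> X \<longrightarrow> emeasure \<mu> K < \<infinity>)"

definition energy_balance ::
  "'a::euclidean_space set \<Rightarrow> real \<Rightarrow> ('a \<times> real \<Rightarrow> 'a) \<Rightarrow> ('a \<times> real \<Rightarrow> real) \<Rightarrow>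
     ('a \<times> real) set \<Rightarrow> ('a \<times> real) measure \<Rightarrow> bool" where
  "energy_balance \<Omega> T u p X \<mu> \<longleftrightarrow>
     (\<forall>\<phi>\<in>Ckc 1 X.
        (LINT z:\<Omega> \<times> {0<..<T}|lborel.
           (norm (u z))\<^sup>2 / 2 * dt \<phi> z + ((norm (u z))\<^sup>2 / 2 + p z) * (u z \<bullet> grad_x \<phi> z))
        = (LINT z|\<mu>. \<phi> z))"

definition anomalous_dissipation ::
  "'a::euclidean_space set \<Rightarrow> real \<Rightarrow> ('a \<times> real \<Rightarrow> 'a) \<Rightarrow> ('a \<times> real \<Rightarrow> real) \<Rightarrow>
     ('a \<times> real) measure \<Rightarrow> bool" where
  "anomalous_dissipation \<Omega> T u p \<mu> \<longleftrightarrow>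
     radon_measure_on (\<Omega> \<times> {0<..<T}) \<mu> \<and>
     energy_balance \<Omega> T u p (\<Omega> \<times> {0<..<T}) \<mu>"

definition boundary_extendable_dissipation ::
  "'a::euclidean_space set \<Rightarrow> real \<Rightarrow> ('a \<times> real \<Rightarrow> 'a) \<Rightarrow> ('a \<times> real \<Rightarrow> real) \<Rightarrow>
     ('a \<times> real) measure \<Rightarrow> bool" where
  "boundary_extendable_dissipation \<Omega> T u p \<mu> \<longleftrightarrow>
     bounded \<Omega> \<and> in_L 3 (\<Omega> \<times> {0<..<T}) u \<and> in_L (3 / 2) (\<Omega> \<times> {0<..<T}) p \<and>
     weak_euler \<Omega> T u p \<and>
     radon_measure_on (closure \<Omega> \<times> {0<..T}) \<mu> \<and>
     energy_balance \<Omega> T u p (closure \<Omega> \<times> {0<..T}) \<mu>"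

definition concentrated_on :: "'b measure \<Rightarrow> 'b set \<Rightarrow> bool" where
  "concentrated_on \<mu> S \<longleftrightarrow> (\<forall>A\<in>sets \<mu>. emeasure \<mu> A = emeasure \<mu> (A \<inter> S))"

definition cylinder :: "real \<Rightarrow> real \<Rightarrow> 'a::euclidean_space \<times> real \<Rightarrow> ('a \<times> real) set" where
  "cylinder \<alpha> \<delta> z =
     ball (fst z) \<delta> \<times> {snd z - \<delta> powr \<alpha> <..< snd z + \<delta> powr \<alpha>}"

text \<open>The index set \<open>I\<close> may be finite, which matters for \<open>s = 0\<close>.\<close>

definition hausdorff_pre ::
  "real \<Rightarrow> real \<Rightarrow> real \<Rightarrow> ('a::euclidean_space \<times> real) set \<Rightarrow> ennreal" where
  "hausdorff_pre \<alpha> s \<rho> A =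
     Inf {(\<Sum>\<^sub>\<infinity>i\<in>I. ennreal (\<delta> i powr s)) | (I :: nat set) (c :: nat \<Rightarrow> 'a \<times> real) \<delta>.
            (\<forall>i\<in>I. 0 < \<delta> i \<and> diameter (cylinder \<alpha> (\<delta> i) (c i)) \<le> \<rho>) \<and>
            A \<subseteq> (\<Union>i\<in>I. cylinder \<alpha> (\<delta> i) (c i))}"

definition hausdorff_aniso ::
  "real \<Rightarrow> real \<Rightarrow> ('a::euclidean_space \<times> real) set \<Rightarrow> ennreal" where
  "hausdorff_aniso \<alpha> s A = Lim (at_right 0) (\<lambda>\<rho>. hausdorff_pre \<alpha> s \<rho> A)"

definition dim_aniso :: "real \<Rightarrow> ('a::euclidean_space \<times> real) set \<Rightarrow> ereal" where
  "dim_aniso \<alpha> A = (INF s\<in>{s. 0 \<le> s \<and> hausdorff_aniso \<alpha> s A = 0}. ereal s)"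

definition abs_cont_hausdorff ::
  "('a::euclidean_space \<times> real) measure \<Rightarrow> real \<Rightarrow> real \<Rightarrow> bool" where
  "abs_cont_hausdorff \<mu> \<alpha> s \<longleftrightarrow>
     (\<forall>A\<in>sets \<mu>. hausdorff_aniso \<alpha> s A = 0 \<longrightarrow> emeasure \<mu> A = 0)"

text \<open>\<open>frac_sub r k\<close> is \<open>(r - k) / r\<close> and \<open>frac_two q\<close> is \<open>2 / q\<close>, with their limits at \<open>\<infinity>\<close>.\<close>

definition frac_sub :: "ennreal \<Rightarrow> real \<Rightarrow> real" where
  "frac_sub r k = (if r = \<infinity> then 1 else (enn2real r - k) / enn2real r)"

definition frac_two :: "ennreal \<Rightarrow> real" where
  "frac_two q = (if q = \<infinity> then 0 else 2 / enn2real q)"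

definition crit_exponent :: "nat \<Rightarrow> real \<Rightarrow> ennreal \<Rightarrow> ennreal \<Rightarrow> real" where
  "crit_exponent d \<alpha> q r =
     min (real d * frac_sub r 2 - \<alpha> * frac_two q)
         (real d * frac_sub r 3 - 1 + \<alpha> * frac_sub q 3)"

lemma crit_exponent_real:
  assumes "0 \<le> q" "0 \<le> r"
  shows "crit_exponent d \<alpha> (ennreal q) (ennreal r) =
    min (d * ((r - 2) / r) - \<alpha> * (2 / q)) (d * ((r - 3) / r) - 1 + \<alpha> * ((q - 3) / q))"
  using assms by (simp add: crit_exponent_def frac_sub_def frac_two_def)

lemma crit_exponent_r_infinity:
  assumes "0 \<le> q"
  shows "crit_exponent d \<alpha> (ennreal q) \<infinity> = min (d - \<alpha> * (2 / q)) (d - 1 + \<alpha> * ((q - 3) / q))"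
  using assms by (simp add: crit_exponent_def frac_sub_def frac_two_def)

lemma crit_exponent_q_infinity:
  assumes "0 \<le> r"
  shows "crit_exponent d \<alpha> \<infinity> (ennreal r) = min (d * ((r - 2) / r)) (d * ((r - 3) / r) - 1 + \<alpha>)"
  using assms by (simp add: crit_exponent_def frac_sub_def frac_two_def)

lemma crit_exponent_infinity: "crit_exponent d \<alpha> \<infinity> \<infinity> = min d (d - 1 + \<alpha>)"
  by (simp add: crit_exponent_def frac_sub_def frac_two_def)

end

theory Submission
  imports Defs
begin

text \<open>
  Test the energy balance with a \<open>C\<^sup>1\<close> cutoff that is at least \<open>1\<close> on a cylinder
  \<open>C\<close> of radius \<open>\<delta>\<close> and time-length \<open>\<delta>\<^sup>\<alpha>\<close>, and that vanishes off a box
  \<open>A \<times> I\<close> twice as large.  Its derivatives are of order \<open>\<delta>\<^sup>-\<^sup>\<alpha>\<close> in time and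
  \<open>\<delta>\<^sup>-\<^sup>1\<close> in space, so positivity of the dissipation and Young's inequality
  \<open>\<bar>p\<bar> \<bar>u\<bar> \<le> \<bar>u\<bar>\<^sup>3 + \<bar>p\<bar> powr (3/2)\<close> bound the dissipation of \<open>C\<close> by a constant times
  \<open>\<delta>\<^sup>-\<^sup>\<alpha>\<close> times the integral of \<open>\<bar>u\<bar>\<^sup>2\<close> over \<open>A \<times> I\<close>, plus \<open>\<delta>\<^sup>-\<^sup>1\<close> times that of
  \<open>\<bar>u\<bar>\<^sup>3 + \<bar>p\<bar> powr (3/2)\<close>.  Hoelder's inequality, first in space and then in time, turns
  these integrals into powers of \<open>\<delta>\<close> times powers of the mixed norms of \<open>u\<close> and \<open>p\<close> over
  the time interval \<open>I\<close>.  The two powers of \<open>\<delta>\<close> are exactly the two entries of the minimum that defines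
  \<open>s\<close>, so the dissipation of \<open>C\<close> is at most \<open>\<eta> \<delta>\<^sup>s\<close>, where \<open>\<eta>\<close> is controlled by the
  norms over \<open>I\<close> (\<open>emeasure_cylinder_le_mixed_norms\<close>, \<open>crit_exponent_scaling\<close>).

  Summing over an economical cover of \<open>B\<close> gives dissipation at most \<open>\<eta> \<H>\<^sup>s(B)\<close>
  (\<open>emeasure_le_hausdorff_aniso\<close>).  In general \<open>\<eta>\<close> is just finite, and null sets of the
  Hausdorff measure have no dissipation.  For \<open>q < \<infinity>\<close> the \<open>q\<close>-th power of the spatial norm is
  integrable in time, so by absolute continuity of the integral \<open>\<eta>\<close> tends to \<open>0\<close> with the
  radii (\<open>Lnorm_indicator_small\<close>); then finite Hausdorff measure already forces zero
  dissipation.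

  The interior and the boundary case differ only in where the cutoffs live.  In the interior the boxes
  stay in a compact product neighbourhood of \<open>B\<close>, on which the local norms are finite.  Up to the
  boundary, test functions need not vanish on the boundary of \<open>\<Omega>\<close> nor at time \<open>T\<close>; the boxes only have to
  keep away from time \<open>0\<close>, and the global norms apply.  Both are instances of
  \<open>emeasure_eq_0_if_hausdorff_aniso\<close>.
\<close>

section \<open>Hoelder's inequality for extended real norms\<close>

lemma ennreal_powr_0 [simp]: "ennreal_powr 0 e = 0"
  by (simp add: ennreal_powr_def)

lemma ennreal_powr_top [simp]: "ennreal_powr top e = top"
  by (simp add: ennreal_powr_def)

lemma ennreal_powr_ennreal [simp]: "0 \<le> x \<Longrightarrow> ennreal_powr (ennreal x) e = ennreal (x powr e)"
  by (simp add: ennreal_powr_def)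

lemma borel_measurable_ennreal_powr [measurable]:
  "(\<lambda>x. ennreal_powr x e) \<in> borel_measurable borel"
  unfolding ennreal_powr_def by measurable

lemma ennreal_powr_indicator:
  "ennreal_powr (x * indicator A z) e = ennreal_powr x e * indicator A z"
  by (simp split: split_indicator)

lemma ennreal_powr_mono:
  assumes "x \<le> y" "0 \<le> e"
  shows "ennreal_powr x e \<le> ennreal_powr y e"
proof (cases "y = top")
  case False
  with assms(1) have "x < top" "y < top"
    by (auto simp: less_top[symmetric] top_unique)
  with assms show ?thesis
    by (auto simp: ennreal_powr_def intro!: ennreal_leI powr_mono2 enn2real_mono)
qed simp

lemma ennreal_powr_powr: "ennreal_powr (ennreal_powr x a) b = ennreal_powr x (a * b)"
  by (cases x) (simp_all add: powr_powr)

lemma ennreal_powr_one [simp]: "ennreal_powr x 1 = x"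
  by (cases x) (simp_all add: )

text \<open>
  Restricting the measure is the same as extending the function by zero, also for \<open>r = \<infinity>\<close>.
  All later estimates are therefore done on the whole space.
\<close>

lemma Lnorm_restrict_space:
  fixes f :: "'b \<Rightarrow> ennreal"
  assumes W: "W \<in> sets M"
  shows "Lnorm r (restrict_space M W) f = Lnorm r M (\<lambda>x. f x * indicator W x)"
proof (cases "r = \<infinity>")
  case True
  have W': "W \<inter> space M \<in> sets M" using W by auto
  have meas: "f \<in> borel_measurable (restrict_space M W) \<longleftrightarrow>
      (\<lambda>x. f x * indicator W x) \<in> borel_measurable M"
    by (rule borel_measurable_restrict_space_iff_ennreal[OF W'])
  have ae: "(AE x in restrict_space M W. f x \<le> z) \<longleftrightarrow> (AE x in M. f x * indicator W x \<le> z)" for z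
    by (subst AE_restrict_space_iff) (use W in \<open>auto intro!: AE_cong simp: indicator_def\<close>)
  show ?thesis
  proof (cases "f \<in> borel_measurable (restrict_space M W)")
    case t: True
    then show ?thesis using True meas ae by (simp add: Lnorm_def esssup_eq_AE)
  next
    case False
    with meas show ?thesis using True by (simp add: Lnorm_def esssup_non_measurable)
  qed
next
  case False
  with W show ?thesis
    by (simp add: Lnorm_def nn_integral_restrict_space ennreal_powr_indicator)
qed

lemma Lnorm_cong:
  assumes "\<And>x. x \<in> space M \<Longrightarrow> f x = g x"
  shows "Lnorm r M f = Lnorm r M g"
proof -
  have m: "f \<in> borel_measurable M \<longleftrightarrow> g \<in> borel_measurable M"
    using assms by (rule measurable_cong)
  have a: "(AE x in M. f x \<le> z) \<longleftrightarrow> (AE x in M. g x \<le> z)" for z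
    using assms by (intro AE_cong) auto
  have "esssup M f = esssup M g"
    by (cases "f \<in> borel_measurable M") (use m in \<open>simp_all add: esssup_eq_AE a esssup_non_measurable\<close>)
  moreover have "(\<integral>\<^sup>+x. ennreal_powr (f x) (enn2real r) \<partial>M) = (\<integral>\<^sup>+x. ennreal_powr (g x) (enn2real r) \<partial>M)"
    using assms by (intro nn_integral_cong) auto
  ultimately show ?thesis by (simp add: Lnorm_def)
qed

lemma Lnorm_zero [simp]: "Lnorm r M (\<lambda>_. 0) = 0"
  by (simp add: Lnorm_def esssup_eq_AE bot_ennreal)

text \<open>
  For \<open>r < \<infinity>\<close> this is Tonelli.  For \<open>r = \<infinity>\<close> the essential supremum of a slice is at most
  \<open>c\<close> iff the slice of \<open>{g > c}\<close> is a null set, and the measure of a slice depends measurably on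
  \<open>t\<close>.
\<close>

lemma borel_measurable_Lnorm_slice:
  fixes g :: "'b \<times> 'c \<Rightarrow> ennreal"
  assumes M: "sigma_finite_measure M" and g[measurable]: "g \<in> borel_measurable (M \<Otimes>\<^sub>M N)"
  shows "(\<lambda>t. Lnorm r M (\<lambda>x. g (x, t))) \<in> borel_measurable N"
proof (cases "r = \<infinity>")
  case False
  interpret sigma_finite_measure M by (rule M)
  have "(\<lambda>t. \<integral>\<^sup>+x. ennreal_powr (g (x, t)) (enn2real r) \<partial>M) \<in> borel_measurable N"
    by (rule borel_measurable_nn_integral) measurable
  then show ?thesis using False unfolding Lnorm_def by simp
next
  case True
  interpret sigma_finite_measure M by (rule M)
  have "{t \<in> space N. esssup M (\<lambda>x. g (x, t)) \<le> c} \<in> sets N" for c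
  proof -
    have gt: "(\<lambda>x. g (x, t)) \<in> borel_measurable M" if "t \<in> space N" for t
      using that by measurable
    have 1: "esssup M (\<lambda>x. g (x, t)) \<le> c \<longleftrightarrow> (AE x in M. g (x, t) \<le> c)" if "t \<in> space N" for t
    proof
      assume "esssup M (\<lambda>x. g (x, t)) \<le> c"
      with esssup_AE[of "\<lambda>x. g (x, t)" M] show "AE x in M. g (x, t) \<le> c"
        by (auto elim: eventually_mono)
    qed (rule esssup_I[OF gt[OF that]])
    have "{t \<in> space N. esssup M (\<lambda>x. g (x, t)) \<le> c} = {t \<in> space N. AE x in M. g (x, t) \<le> c}"
      using 1 by auto
    also have "\<dots> = {t \<in> space N. (\<integral>\<^sup>+x. indicator {z \<in> space (M \<Otimes>\<^sub>M N). c < g z} (x, t) \<partial>M) = 0}"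
    proof (intro Collect_cong conj_cong refl)
      fix t assume t: "t \<in> space N"
      have "(\<lambda>x. indicator {z \<in> space (M \<Otimes>\<^sub>M N). c < g z} (x, t) :: ennreal) \<in> borel_measurable M"
        using t by measurable
      then show "(AE x in M. g (x, t) \<le> c) \<longleftrightarrow>
          (\<integral>\<^sup>+x. indicator {z \<in> space (M \<Otimes>\<^sub>M N). c < g z} (x, t) \<partial>M) = (0::ennreal)"
        using t by (subst nn_integral_0_iff_AE)
          (auto intro!: AE_cong simp: space_pair_measure indicator_def)
    qed
    also have "\<dots> \<in> sets N" by measurable
    finally show ?thesis .
  qed
  then show ?thesis using True unfolding Lnorm_def
    by (auto intro!: borel_measurableI_le)
qed

text \<open>
  Hoelder's inequality against the indicator of \<open>A\<close>.  With \<open>\<theta> = k/r\<close>, weighted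
  arithmetic-geometric means bound \<open>(f\<^sup>r / N)\<^sup>\<theta> (1/V)\<^sup>1\<^sup>-\<^sup>\<theta>\<close>, where \<open>N\<close> is the integral of
  \<open>f\<^sup>r\<close>, by a sum whose integral over \<open>A\<close> is at most \<open>\<theta> + (1 - \<theta>) = 1\<close>.  A positive upper
  bound \<open>V\<close> stands in for the measure of \<open>A\<close>, so that dividing by it is harmless and null
  sets are no special case.
\<close>

lemma nn_integral_powr_le_Lnorm:
  fixes f :: "'b \<Rightarrow> ennreal"
  assumes f[measurable]: "f \<in> borel_measurable M" and A[measurable]: "A \<in> sets M"
    and V: "emeasure M A \<le> ennreal V" "0 < V" and k: "0 < k" "ennreal k \<le> r"
  shows "(\<integral>\<^sup>+x\<in>A. ennreal_powr (f x) k \<partial>M)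
    \<le> ennreal_powr (Lnorm r M f) k * ennreal (V powr frac_sub r k)"
proof (cases "r = \<infinity>")
  case True
  have "(\<integral>\<^sup>+x\<in>A. ennreal_powr (f x) k \<partial>M) \<le> (\<integral>\<^sup>+x\<in>A. ennreal_powr (esssup M f) k \<partial>M)"
    using esssup_AE[of f M] k
    by (intro nn_integral_mono_AE) (auto intro!: mult_right_mono ennreal_powr_mono elim!: eventually_mono)
  also have "\<dots> = ennreal_powr (esssup M f) k * emeasure M A"
    by (simp add: nn_integral_cmult_indicator)
  also have "\<dots> \<le> ennreal_powr (esssup M f) k * ennreal V"
    using V by (intro mult_left_mono) auto
  finally show ?thesis using True V by (simp add: Lnorm_def frac_sub_def)
next
  case False
  define R where "R = enn2real r"
  have r: "r = ennreal R" and Rk: "k \<le> R"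
    using False k by (cases r; simp add: R_def)+
  define N where "N = (\<integral>\<^sup>+x. ennreal_powr (f x) R \<partial>M)"
  have L: "ennreal_powr (Lnorm r M f) k = ennreal_powr N (k / R)"
    using False by (simp add: Lnorm_def N_def R_def ennreal_powr_powr)
  define \<theta> where "\<theta> = k / R"
  have th: "0 < \<theta>" "\<theta> \<le> 1" using k Rk by (auto simp: \<theta>_def)
  have fs: "frac_sub r k = 1 - \<theta>" using False k Rk by (simp add: frac_sub_def R_def \<theta>_def field_simps)
  consider "N = top" | "N = 0" | n where "N = ennreal n" "0 < n"
    by (cases N) (auto simp: less_le)
  then show ?thesis
  proof cases
    case 1
    then show ?thesis using V unfolding L by (simp add: ennreal_top_mult)
  next
    case 2
    then have "AE x in M. ennreal_powr (f x) R = 0"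
      unfolding N_def by (subst (asm) nn_integral_0_iff_AE) auto
    then have "AE x in M. ennreal_powr (f x) k * indicator A x = 0"
    proof (eventually_elim)
      case (elim x)
      then show ?case by (cases "f x") auto
    qed
    then have "(\<integral>\<^sup>+x\<in>A. ennreal_powr (f x) k \<partial>M) = 0"
      by (subst nn_integral_0_iff_AE) auto
    then show ?thesis by simp
  next
    case 3
    define C where "C = n powr \<theta> * V powr (1 - \<theta>)"
    have C: "C > 0" using 3 V by (simp add: C_def)
    \<comment> \<open>The value \<open>y = \<infinity>\<close> has to be covered as well, since \<open>f\<close> will itself be a norm.\<close>
    have pt: "ennreal_powr y k \<le> ennreal (C * \<theta> / n) * ennreal_powr y R + ennreal (C * (1 - \<theta>) / V)" for y
    proof (cases y)
      case (real a)
      show ?thesis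
      proof (cases "a = 0")
        case True
        with real k show ?thesis by simp
      next
        case a: False
        have "(a powr R / n) powr \<theta> * (1 / V) powr (1 - \<theta>) \<le> \<theta> * (a powr R / n) + (1 - \<theta>) * (1 / V)"
          using th 3 V a by (intro Youngs_inequality_0) auto
        moreover have "(a powr R / n) powr \<theta> * (1 / V) powr (1 - \<theta>) = a powr k / C"
          using th 3 V k Rk by (simp add: powr_divide powr_powr \<theta>_def C_def)
        ultimately have "a powr k / C \<le> \<theta> * (a powr R / n) + (1 - \<theta>) * (1 / V)"
          by simp
        then have "a powr k \<le> (\<theta> * (a powr R / n) + (1 - \<theta>) * (1 / V)) * C"
          using C by (simp only: pos_divide_le_eq)
        then have "a powr k \<le> C * \<theta> / n * a powr R + C * (1 - \<theta>) / V"
          by (simp add: algebra_simps add_divide_distrib diff_divide_distrib)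
        then show ?thesis using real C th 3 V
          by (simp add: ennreal_mult'[symmetric] ennreal_plus[symmetric] del: ennreal_plus)
      qed
    next
      case top
      have "C * \<theta> / n > 0" using C th 3 by simp
      with top C th 3 show ?thesis by (simp add: ennreal_mult_top)
    qed
    have "(\<integral>\<^sup>+x\<in>A. ennreal_powr (f x) k \<partial>M)
      \<le> (\<integral>\<^sup>+x. ennreal (C * \<theta> / n) * ennreal_powr (f x) R + ennreal (C * (1 - \<theta>) / V) * indicator A x \<partial>M)"
      using pt by (intro nn_integral_mono) (auto split: split_indicator)
    also have "\<dots> = ennreal (C * \<theta> / n) * N + ennreal (C * (1 - \<theta>) / V) * emeasure M A"
      by (simp add: nn_integral_add nn_integral_cmult N_def nn_integral_cmult_indicator)
    also have "\<dots> \<le> ennreal (C * \<theta> / n) * ennreal n + ennreal (C * (1 - \<theta>) / V) * ennreal V"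
      using V 3 by (intro add_mono mult_left_mono) auto
    also have "\<dots> = ennreal (C * \<theta> + C * (1 - \<theta>))"
      using C th 3 V by (simp add: ennreal_mult'[symmetric] ennreal_plus[symmetric] del: ennreal_plus)
    also have "C * \<theta> + C * (1 - \<theta>) = C" by (simp add: algebra_simps)
    also have "\<dots> = ennreal_powr (Lnorm r M f) k * ennreal (V powr frac_sub r k)"
      using 3 by (simp add: L fs C_def \<theta>_def ennreal_mult')
    finally show ?thesis .
  qed
qed

section \<open>Mixed norms over small boxes\<close>

text \<open>
  Hoelder's inequality in space for fixed time, and then in time.  The norm on the right sees only
  the time interval \<open>I\<close>, which is what later makes it small.
\<close>

lemma nn_integral_powr_cylinder_le:
  fixes g :: "'a::euclidean_space \<times> real \<Rightarrow> ennreal"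
  assumes g[measurable]: "g \<in> borel_measurable borel"
    and A[measurable]: "A \<in> sets borel" and I[measurable]: "I \<in> sets borel"
    and V: "emeasure lborel A \<le> ennreal V" "0 < V" and L: "emeasure lborel I \<le> ennreal L" "0 < L"
    and k: "0 < k" "ennreal k \<le> r" "ennreal k \<le> q"
  shows "(\<integral>\<^sup>+z\<in>A \<times> I. ennreal_powr (g z) k \<partial>lborel)
    \<le> ennreal (V powr frac_sub r k * L powr frac_sub q k) *
      ennreal_powr (Lnorm q lborel (\<lambda>t. Lnorm r lborel (\<lambda>x. g (x, t)) * indicator I t)) k"
proof -
  have g'[measurable]: "g \<in> borel_measurable (lborel \<Otimes>\<^sub>M lborel)"
    using g by (simp add: lborel_prod)
  define F where "F t = Lnorm r lborel (\<lambda>x. g (x, t))" for t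
  have F[measurable]: "F \<in> borel_measurable borel"
    using borel_measurable_Lnorm_slice[OF sigma_finite_lborel g', of r] by (simp add: F_def[abs_def])
  have "(\<integral>\<^sup>+z\<in>A \<times> I. ennreal_powr (g z) k \<partial>lborel)
      = (\<integral>\<^sup>+z. ennreal_powr (g z) k * indicator (A \<times> I) z \<partial>(lborel \<Otimes>\<^sub>M lborel))"
    by (simp add: lborel_prod)
  also have "\<dots> = (\<integral>\<^sup>+t. \<integral>\<^sup>+x. ennreal_powr (g (x, t)) k * indicator (A \<times> I) (x, t) \<partial>lborel \<partial>lborel)"
    by (subst lborel_pair.nn_integral_snd[symmetric]) (auto simp: case_prod_beta')
  also have "\<dots> \<le> (\<integral>\<^sup>+t. ennreal (V powr frac_sub r k) * (ennreal_powr (F t * indicator I t) k * indicator I t) \<partial>lborel)"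
  proof (rule nn_integral_mono)
    fix t
    have "(\<integral>\<^sup>+x\<in>A. ennreal_powr (g (x, t)) k \<partial>lborel) \<le> ennreal_powr (F t) k * ennreal (V powr frac_sub r k)"
      unfolding F_def using V k by (intro nn_integral_powr_le_Lnorm) auto
    then show "(\<integral>\<^sup>+x. ennreal_powr (g (x, t)) k * indicator (A \<times> I) (x, t) \<partial>lborel)
        \<le> ennreal (V powr frac_sub r k) * (ennreal_powr (F t * indicator I t) k * indicator I t)"
      by (auto simp: indicator_times mult.commute split: split_indicator)
  qed
  also have "\<dots> = ennreal (V powr frac_sub r k) * (\<integral>\<^sup>+t\<in>I. ennreal_powr (F t * indicator I t) k \<partial>lborel)"
    by (rule nn_integral_cmult) measurable
  also have "\<dots> \<le> ennreal (V powr frac_sub r k) *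
      (ennreal_powr (Lnorm q lborel (\<lambda>t. F t * indicator I t)) k * ennreal (L powr frac_sub q k))"
    using L k by (intro mult_left_mono nn_integral_powr_le_Lnorm) auto
  finally show ?thesis
    by (simp add: F_def ennreal_mult' mult_ac)
qed

text \<open>
  Absolute continuity of the integral of \<open>h = F\<^sup>q\<close>: replacing \<open>h\<close> by \<open>min h n\<close> for large \<open>n\<close>
  changes the integral by at most \<open>e\<close>, and \<open>min h n\<close> contributes at most \<open>n\<close> times the measure of
  \<open>I\<close>.
\<close>

lemma Lnorm_indicator_small:
  fixes F :: "'b \<Rightarrow> ennreal"
  assumes F[measurable]: "F \<in> borel_measurable M" and q: "0 < q" "q < \<infinity>"
    and fin: "Lnorm q M F < \<infinity>" and \<eta>: "0 < \<eta>"
  shows "\<exists>l>0. \<forall>I\<in>sets M. emeasure M I \<le> ennreal l \<longrightarrow>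
    Lnorm q M (\<lambda>t. F t * indicator I t) \<le> ennreal \<eta>"
proof -
  define Q where "Q = enn2real q"
  have Q: "Q > 0" using q by (simp add: Q_def enn2real_positive_iff)
  define h where "h t = ennreal_powr (F t) Q" for t
  have h[measurable]: "h \<in> borel_measurable M" unfolding h_def by measurable
  have hfin: "(\<integral>\<^sup>+t. h t \<partial>M) \<noteq> \<infinity>"
  proof
    assume "(\<integral>\<^sup>+t. h t \<partial>M) = \<infinity>"
    then have "Lnorm q M F = \<infinity>" using q by (auto simp: Lnorm_def h_def Q_def)
    with fin show False by simp
  qed
  \<comment> \<open>Half of the budget for \<open>\<integral> h\<close> over \<open>I\<close> goes to the truncation error, half to the truncated part.\<close>
  define e where "e = \<eta> powr Q / 2"
  have e: "e > 0" using \<eta> by (simp add: e_def)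
  have "(\<lambda>n. \<integral>\<^sup>+t. min (h t) (of_nat n) \<partial>M) \<longlonglongrightarrow> (\<integral>\<^sup>+t. h t \<partial>M)"
  proof (rule nn_integral_LIMSEQ)
    show "incseq (\<lambda>n t. min (h t) (of_nat n))"
      by (intro monoI le_funI min.mono) auto
    show "(\<lambda>n. min (h t) (of_nat n)) \<longlonglongrightarrow> h t" for t
    proof (cases "h t")
      case (real a)
      obtain N where "a \<le> real N" using real_arch_simple by blast
      then have "eventually (\<lambda>n. min (h t) (of_nat n) = h t) sequentially"
        using real by (auto intro!: eventually_sequentiallyI[of N] min.absorb1 simp: ennreal_of_nat_eq_real_of_nat)
      then show ?thesis by (rule tendsto_eventually)
    qed (simp add: of_nat_tendsto_top_ennreal)
  qed auto
  then have "\<exists>n. (\<integral>\<^sup>+t. h t \<partial>M) \<le> (\<integral>\<^sup>+t. min (h t) (of_nat n) \<partial>M) + ennreal e"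
  proof -
    assume lim: "(\<lambda>n. \<integral>\<^sup>+t. min (h t) (of_nat n) \<partial>M) \<longlonglongrightarrow> (\<integral>\<^sup>+t. h t \<partial>M)"
    have "(\<lambda>n. (\<integral>\<^sup>+t. min (h t) (of_nat n) \<partial>M) + ennreal e) \<longlonglongrightarrow> (\<integral>\<^sup>+t. h t \<partial>M) + ennreal e"
      by (intro tendsto_add lim tendsto_const)
    moreover have "(\<integral>\<^sup>+t. h t \<partial>M) < (\<integral>\<^sup>+t. h t \<partial>M) + ennreal e"
      using hfin e ennreal_add_left_cancel_less[of "\<integral>\<^sup>+t. h t \<partial>M" 0 "ennreal e"] by simp
    ultimately have "\<forall>\<^sub>F n in sequentially. (\<integral>\<^sup>+t. h t \<partial>M) < (\<integral>\<^sup>+t. min (h t) (of_nat n) \<partial>M) + ennreal e"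
      by (rule order_tendstoD(1))
    then show ?thesis
      by (auto simp: eventually_sequentially intro: less_imp_le)
  qed
  then obtain n where n: "(\<integral>\<^sup>+t. h t \<partial>M) \<le> (\<integral>\<^sup>+t. min (h t) (of_nat n) \<partial>M) + ennreal e" ..
  show ?thesis
  proof (intro exI[of _ "e / (real n + 1)"] conjI ballI impI)
    \<comment> \<open>The summand \<open>1\<close> covers \<open>n = 0\<close>.\<close>
    show "0 < e / (real n + 1)" using e by simp
    fix I assume I[measurable]: "I \<in> sets M" and small: "emeasure M I \<le> ennreal (e / (real n + 1))"
    let ?J = "space M - I"
    have split: "(\<integral>\<^sup>+t. k t \<partial>M) = (\<integral>\<^sup>+t\<in>I. k t \<partial>M) + (\<integral>\<^sup>+t\<in>?J. k t \<partial>M)"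
      if [measurable]: "k \<in> borel_measurable M" for k :: "'b \<Rightarrow> ennreal"
      by (subst nn_integral_add[symmetric]) (auto intro!: nn_integral_cong split: split_indicator)
    have "(\<integral>\<^sup>+t\<in>I. h t \<partial>M) + (\<integral>\<^sup>+t\<in>?J. h t \<partial>M)
        \<le> ((\<integral>\<^sup>+t\<in>I. min (h t) (of_nat n) \<partial>M) + (\<integral>\<^sup>+t\<in>?J. min (h t) (of_nat n) \<partial>M)) + ennreal e"
      using n split[of h] split[of "\<lambda>t. min (h t) (of_nat n)"] by simp
    also have "\<dots> \<le> ((\<integral>\<^sup>+t. of_nat n * indicator I t \<partial>M) + (\<integral>\<^sup>+t\<in>?J. h t \<partial>M)) + ennreal e"
      by (intro add_mono nn_integral_mono) (auto split: split_indicator)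
    also have "(\<integral>\<^sup>+t. of_nat n * indicator I t \<partial>M) \<le> ennreal e"
    proof -
      have "(\<integral>\<^sup>+t. of_nat n * indicator I t \<partial>M) = of_nat n * emeasure M I"
        by (simp add: nn_integral_cmult_indicator)
      also have "\<dots> \<le> ennreal (real n) * ennreal (e / (real n + 1))"
        using small by (intro mult_mono) (auto simp: ennreal_of_nat_eq_real_of_nat)
      also have "\<dots> \<le> ennreal e"
        using e by (auto simp: ennreal_mult'[symmetric] field_simps intro!: ennreal_leI)
      finally show ?thesis .
    qed
    finally have "(\<integral>\<^sup>+t\<in>?J. h t \<partial>M) + (\<integral>\<^sup>+t\<in>I. h t \<partial>M) \<le> (\<integral>\<^sup>+t\<in>?J. h t \<partial>M) + (ennreal e + ennreal e)"
      by (simp add: ac_simps)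
    moreover have "(\<integral>\<^sup>+t\<in>?J. h t \<partial>M) < \<infinity>"
    proof -
      have "(\<integral>\<^sup>+t\<in>?J. h t \<partial>M) \<le> (\<integral>\<^sup>+t. h t \<partial>M)"
        by (intro nn_integral_mono) (auto split: split_indicator)
      then show ?thesis using hfin by (auto simp: less_top[symmetric] top_unique)
    qed
    ultimately have "(\<integral>\<^sup>+t\<in>I. h t \<partial>M) \<le> ennreal e + ennreal e"
      by (auto simp: ennreal_add_left_cancel_le)
    also have "\<dots> = ennreal (\<eta> powr Q)" using e by (simp add: ennreal_plus[symmetric] e_def del: ennreal_plus)
    finally have "ennreal_powr (\<integral>\<^sup>+t\<in>I. h t \<partial>M) (1 / Q) \<le> ennreal_powr (ennreal (\<eta> powr Q)) (1 / Q)"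
      using Q by (intro ennreal_powr_mono) auto
    also have "\<dots> = ennreal \<eta>" using \<eta> Q by (simp add: powr_powr)
    finally show "Lnorm q M (\<lambda>t. F t * indicator I t) \<le> ennreal \<eta>"
      using q by (auto simp: Lnorm_def h_def Q_def ennreal_powr_indicator)
  qed
qed

lemma Lnorm_mono_indicator:
  fixes F :: "'b \<Rightarrow> ennreal"
  assumes F[measurable]: "F \<in> borel_measurable M" and I[measurable]: "I \<in> sets M"
  shows "Lnorm q M (\<lambda>t. F t * indicator I t) \<le> Lnorm q M F"
  unfolding Lnorm_def
  by (auto intro!: esssup_mono ennreal_powr_mono nn_integral_mono split: split_indicator)

text \<open>
  Membership in \<open>in_LL\<close> seen on the whole space, where \<open>\<real>\<^sup>d \<times> \<real>\<close> carries a product measure and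
  slices are unrestricted.
\<close>

lemma in_LL_zero_extension:
  fixes f :: "'a::euclidean_space \<times> real \<Rightarrow> 'c::real_normed_vector"
  assumes f: "in_LL q r J W f" and W[measurable]: "W \<in> sets borel" and J[measurable]: "J \<in> sets borel"
  defines "g \<equiv> \<lambda>z. ennreal (norm (f z)) * indicator (W \<times> J) z"
  shows "g \<in> borel_measurable borel"
    and "Lnorm q lborel (\<lambda>t. Lnorm r lborel (\<lambda>x. g (x, t))) < \<infinity>"
proof -
  have WJ[measurable]: "W \<times> J \<in> sets borel"
    using W J by (rule borel_Times)
  have [measurable]: "f \<in> borel_measurable (restrict_space lborel (W \<times> J))"
    using f by (simp only: in_LL_def)
  have "(\<lambda>z. ennreal (norm (f z))) \<in> borel_measurable (restrict_space lborel (W \<times> J))"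
    by measurable
  then show "g \<in> borel_measurable borel"
    unfolding g_def using WJ
    by (subst (asm) borel_measurable_restrict_space_iff_ennreal) auto
  define F where "F t = Lnorm r lborel (\<lambda>x. g (x, t))" for t
  have "Lnorm q (restrict_space lborel J) F < \<infinity>"
  proof -
    have "Lnorm r (restrict_space lborel W) (\<lambda>x. ennreal (norm (f (x, t)))) = F t"
      if "t \<in> space (restrict_space lborel J)" for t
      using that unfolding F_def g_def
      by (subst Lnorm_restrict_space) (auto simp: indicator_times space_restrict_space)
    then have "Lnorm q (restrict_space lborel J) F =
       Lnorm q (restrict_space lborel J) (\<lambda>t. Lnorm r (restrict_space lborel W) (\<lambda>x. ennreal (norm (f (x, t)))))"
      by (intro Lnorm_cong) simp
    then show ?thesis using f by (simp add: in_LL_def)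
  qed
  moreover have "Lnorm q (restrict_space lborel J) F = Lnorm q lborel (\<lambda>t. F t * indicator J t)"
    by (rule Lnorm_restrict_space) simp
  moreover have "F t * indicator J t = F t" for t
    by (auto simp: F_def g_def indicator_times split: split_indicator)
  ultimately show "Lnorm q lborel (\<lambda>t. Lnorm r lborel (\<lambda>x. g (x, t))) < \<infinity>"
    by (simp add: F_def)
qed

section \<open>Cutoff functions adapted to a cylinder\<close>

text \<open>
  The squared positive part is a \<open>C\<^sup>1\<close> profile.  It is applied to the squared scaled distance, so that
  the cutoff is differentiable at its centre too.
\<close>

definition bump :: "real \<Rightarrow> real" where
  "bump y = (max 0 (2 - y))\<^sup>2"

text \<open>
  At the junction \<open>y = 2\<close> the difference quotient is at most \<open>\<bar>h\<bar>\<close>.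
\<close>

lemma has_real_derivative_bump: "(bump has_real_derivative - 2 * max 0 (2 - y)) (at y)"
proof -
  consider "y < 2" | "y > 2" | "y = 2" by linarith
  then show ?thesis
  proof cases
    case 1
    have "((\<lambda>y. (2 - y)\<^sup>2) has_real_derivative - 2 * max 0 (2 - y)) (at y)"
      using 1 by (auto intro!: derivative_eq_intros)
    then show ?thesis
      by (rule has_field_derivative_transform_within_open[where S = "{..<2}"])
        (use 1 in \<open>auto simp: bump_def\<close>)
  next
    case 2
    have "((\<lambda>y. 0) has_real_derivative - 2 * max 0 (2 - y)) (at y)"
      using 2 by (auto intro!: derivative_eq_intros)
    then show ?thesis
      by (rule has_field_derivative_transform_within_open[where S = "{2<..}"])
        (use 2 in \<open>auto simp: bump_def\<close>)
  next
    case 3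
    have "((\<lambda>h. (bump (2 + h) - bump 2) / h) \<longlongrightarrow> 0) (at 0)"
    proof (rule Lim_null_comparison)
      show "\<forall>\<^sub>F h in at 0. norm ((bump (2 + h) - bump 2) / h) \<le> \<bar>h\<bar>"
        by (auto simp: bump_def eventually_at_filter max_def power2_eq_square)
      show "((\<lambda>h. \<bar>h\<bar>) \<longlongrightarrow> 0) (at (0::real))"
        by (rule tendsto_eq_intros | simp)+
    qed
    then show ?thesis using 3 by (simp add: DERIV_def)
  qed
qed

lemma bump_bounds:
  "0 \<le> bump y" "0 \<le> y \<Longrightarrow> bump y \<le> 4" "y \<le> 1 \<Longrightarrow> 1 \<le> bump y" "2 \<le> y \<Longrightarrow> bump y = 0"
proof -
  show "bump y \<le> 4" if "0 \<le> y"
    using power_mono[of "max 0 (2 - y)" 2 2] that by (simp add: bump_def)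
  show "1 \<le> bump y" if "y \<le> 1"
    using power_mono[of 1 "max 0 (2 - y)" 2] that by (simp add: bump_def)
qed (auto simp: bump_def)

lemma bump_has_derivative [derivative_intros]:
  assumes "(f has_derivative f') (at z)"
  shows "((\<lambda>z. bump (f z)) has_derivative (\<lambda>h. - 2 * max 0 (2 - f z) * f' h)) (at z)"
  using has_derivative_compose[OF assms has_real_derivative_bump[THEN has_field_derivative_imp_has_derivative]]
  by simp

definition cutoff :: "real \<Rightarrow> real \<Rightarrow> 'a::euclidean_space \<times> real \<Rightarrow> 'a \<times> real \<Rightarrow> real" where
  "cutoff \<delta> \<tau> c z = bump ((norm (fst z - fst c))\<^sup>2 / \<delta>\<^sup>2) * bump ((snd z - snd c)\<^sup>2 / \<tau>\<^sup>2)"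

lemma has_derivative_cutoff:
  "(cutoff \<delta> \<tau> c has_derivative
    (\<lambda>h. - 4 * max 0 (2 - (norm (fst z - fst c))\<^sup>2 / \<delta>\<^sup>2) * bump ((snd z - snd c)\<^sup>2 / \<tau>\<^sup>2) / \<delta>\<^sup>2
            * ((fst z - fst c) \<bullet> fst h)
          - 4 * max 0 (2 - (snd z - snd c)\<^sup>2 / \<tau>\<^sup>2) * bump ((norm (fst z - fst c))\<^sup>2 / \<delta>\<^sup>2) / \<tau>\<^sup>2
            * ((snd z - snd c) * snd h))) (at z)"
proof -
  have x: "((\<lambda>z. (norm (fst z - fst c))\<^sup>2 / \<delta>\<^sup>2) has_derivative (\<lambda>h. 2 * ((fst z - fst c) \<bullet> fst h) / \<delta>\<^sup>2)) (at z)"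
    unfolding power2_norm_eq_inner divide_inverse
    by (rule derivative_eq_intros refl | simp add: inner_commute algebra_simps)+
  have t: "((\<lambda>z. (snd z - snd c)\<^sup>2 / \<tau>\<^sup>2) has_derivative (\<lambda>h. 2 * ((snd z - snd c) * snd h) / \<tau>\<^sup>2)) (at z)"
    unfolding divide_inverse
    by (rule derivative_eq_intros refl | simp add: inner_commute algebra_simps)+
  show ?thesis
    unfolding cutoff_def[abs_def]
    by (rule has_derivative_eq_rhs[OF has_derivative_mult[OF bump_has_derivative[OF x] bump_has_derivative[OF t]]])
      (simp add: fun_eq_iff algebra_simps)
qed

lemma continuous_on_bump [continuous_intros]:
  "continuous_on S f \<Longrightarrow> continuous_on S (\<lambda>z. bump (f z))"
  unfolding bump_def by (intro continuous_intros)

lemma Ck_cutoff: "Ck 1 (cutoff \<delta> \<tau> c)"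
  unfolding One_nat_def Ck.simps frechet_derivative_at[OF has_derivative_cutoff, symmetric]
  by (auto simp: differentiable_def divide_inverse intro!: has_derivative_cutoff continuous_intros)

lemma cutoff_nonneg: "0 \<le> cutoff \<delta> \<tau> c z"
  by (simp add: cutoff_def bump_bounds)

lemma cutoff_ge_1:
  assumes "norm (fst z - fst c) \<le> \<delta>" "\<bar>snd z - snd c\<bar> \<le> \<tau>"
  shows "1 \<le> cutoff \<delta> \<tau> c z"
proof -
  have "(norm (fst z - fst c))\<^sup>2 \<le> \<delta>\<^sup>2" "(snd z - snd c)\<^sup>2 \<le> \<tau>\<^sup>2"
    using assms by (auto intro: power_mono simp: abs_le_square_iff[symmetric])
  then have "(norm (fst z - fst c))\<^sup>2 / \<delta>\<^sup>2 \<le> 1" "(snd z - snd c)\<^sup>2 / \<tau>\<^sup>2 \<le> 1"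
    by (auto simp: divide_le_eq_1)
  then show ?thesis
    unfolding cutoff_def using mult_mono[of 1 _ 1] by (fastforce dest: bump_bounds(3))
qed

text \<open>
  The cutoff already vanishes at \<open>\<surd>2\<close> times the radius; twice the radius is a convenient bound.
\<close>

definition doubled_box :: "real \<Rightarrow> real \<Rightarrow> 'a::euclidean_space \<times> real \<Rightarrow> ('a \<times> real) set" where
  "doubled_box \<delta> \<tau> c = ball (fst c) (2 * \<delta>) \<times> ball (snd c) (2 * \<tau>)"

lemma scaled_square_ge_2:
  fixes a b :: real
  assumes "0 < b" "2 * b \<le> \<bar>a\<bar>"
  shows "2 \<le> a\<^sup>2 / b\<^sup>2"
proof -
  have "(2 * b)\<^sup>2 \<le> a\<^sup>2"
    using assms power_mono[of "2 * b" "\<bar>a\<bar>" 2] by simp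
  then have "4 * b\<^sup>2 \<le> a\<^sup>2"
    by (simp add: power_mult_distrib)
  then have "2 * b\<^sup>2 \<le> a\<^sup>2"
    using zero_le_power2[of b] by linarith
  moreover have "b\<^sup>2 > 0" using assms by simp
  ultimately show ?thesis by (simp add: pos_le_divide_eq)
qed

lemma outside_doubled_box:
  assumes "0 < \<delta>" "0 < \<tau>" "z \<notin> doubled_box \<delta> \<tau> c"
  shows "2 \<le> (norm (fst z - fst c))\<^sup>2 / \<delta>\<^sup>2 \<or> 2 \<le> (snd z - snd c)\<^sup>2 / \<tau>\<^sup>2"
proof -
  have "2 * \<delta> \<le> \<bar>norm (fst z - fst c)\<bar> \<or> 2 * \<tau> \<le> \<bar>snd z - snd c\<bar>"
    using assms(3) by (cases z) (auto simp: doubled_box_def dist_norm dist_real_def norm_minus_commute abs_minus_commute)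
  then show ?thesis using scaled_square_ge_2 assms by blast
qed

lemma cutoff_eq_0:
  assumes "0 < \<delta>" "0 < \<tau>" "z \<notin> doubled_box \<delta> \<tau> c"
  shows "cutoff \<delta> \<tau> c z = 0"
  using outside_doubled_box[OF assms] by (auto simp: cutoff_def bump_bounds)

text \<open>
  The profile factors are at most \<open>2\<close> and \<open>4\<close>, and inside the box the offset from the centre is at most
  twice the scale; this gives \<open>4 * 2 * 4 * 2 = 64\<close>, here and for the spatial gradient.
\<close>

lemma dt_cutoff_le:
  assumes "0 < \<delta>" "0 < \<tau>"
  shows "\<bar>dt (cutoff \<delta> \<tau> c) z\<bar> \<le> 64 / \<tau> * indicator (doubled_box \<delta> \<tau> c) z"
proof -
  let ?X = "(norm (fst z - fst c))\<^sup>2 / \<delta>\<^sup>2" and ?T = "(snd z - snd c)\<^sup>2 / \<tau>\<^sup>2"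
  have eq: "dt (cutoff \<delta> \<tau> c) z = - 4 * max 0 (2 - ?T) * bump ?X / \<tau>\<^sup>2 * (snd z - snd c)"
    by (simp add: dt_def frechet_derivative_at[OF has_derivative_cutoff, symmetric])
  show ?thesis
  proof (cases "z \<in> doubled_box \<delta> \<tau> c")
    case True
    then have s: "\<bar>snd z - snd c\<bar> \<le> 2 * \<tau>"
      by (auto simp: doubled_box_def dist_real_def)
    have "\<bar>dt (cutoff \<delta> \<tau> c) z\<bar> = 4 * max 0 (2 - ?T) * bump ?X / \<tau>\<^sup>2 * \<bar>snd z - snd c\<bar>"
      unfolding eq by (simp add: abs_mult bump_bounds)
    also have "\<dots> \<le> 4 * 2 * 4 / \<tau>\<^sup>2 * (2 * \<tau>)"
      using s assms by (intro mult_mono divide_right_mono) (auto simp: bump_bounds)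
    also have "\<dots> = 64 / \<tau>" using assms by (simp add: power2_eq_square)
    finally show ?thesis using True by simp
  next
    case False
    then show ?thesis using outside_doubled_box[OF assms False] by (auto simp: eq bump_bounds)
  qed
qed

lemma grad_x_cutoff_le:
  assumes "0 < \<delta>" "0 < \<tau>"
  shows "norm (grad_x (cutoff \<delta> \<tau> c) z) \<le> 64 / \<delta> * indicator (doubled_box \<delta> \<tau> c) z"
proof -
  let ?X = "(norm (fst z - fst c))\<^sup>2 / \<delta>\<^sup>2" and ?T = "(snd z - snd c)\<^sup>2 / \<tau>\<^sup>2"
  let ?a = "- 4 * max 0 (2 - ?X) * bump ?T / \<delta>\<^sup>2"
  have "dx i (cutoff \<delta> \<tau> c) z = ?a * ((fst z - fst c) \<bullet> i)" for i
    by (simp add: dx_def frechet_derivative_at[OF has_derivative_cutoff, symmetric])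
  then have "grad_x (cutoff \<delta> \<tau> c) z = (\<Sum>i\<in>Basis. ?a *\<^sub>R (((fst z - fst c) \<bullet> i) *\<^sub>R i))"
    by (simp add: grad_x_def)
  also have "\<dots> = ?a *\<^sub>R (fst z - fst c)"
    by (simp only: scaleR_sum_right[symmetric] euclidean_representation)
  finally have eq: "grad_x (cutoff \<delta> \<tau> c) z = ?a *\<^sub>R (fst z - fst c)" .
  show ?thesis
  proof (cases "z \<in> doubled_box \<delta> \<tau> c")
    case True
    then have s: "norm (fst z - fst c) \<le> 2 * \<delta>"
      by (auto simp: doubled_box_def dist_norm norm_minus_commute)
    have "norm (grad_x (cutoff \<delta> \<tau> c) z) = 4 * max 0 (2 - ?X) * bump ?T / \<delta>\<^sup>2 * norm (fst z - fst c)"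
      unfolding eq by (simp add: abs_mult bump_bounds)
    also have "\<dots> \<le> 4 * 2 * 4 / \<delta>\<^sup>2 * (2 * \<delta>)"
      using s assms by (intro mult_mono divide_right_mono) (auto simp: bump_bounds)
    also have "\<dots> = 64 / \<delta>" using assms by (simp add: power2_eq_square)
    finally show ?thesis using True by simp
  next
    case False
    then show ?thesis using outside_doubled_box[OF assms False] by (auto simp: eq bump_bounds)
  qed
qed

section \<open>Dissipation of a cylinder\<close>

text \<open>
  These make Hoelder's inequality for \<open>p\<close>, with exponents \<open>3/2\<close> and \<open>r/2\<close>, yield the same power of the
  volume as the one for \<open>u\<close>, with exponents \<open>3\<close> and \<open>r\<close>.
\<close>

lemma ennreal_half_exponent:
  fixes r :: ennreal
  shows "r / 2 = \<infinity> \<longleftrightarrow> r = \<infinity>" "enn2real (r / 2) = enn2real r / 2"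
    "frac_sub (r / 2) (3 / 2) = frac_sub r 3" "3 \<le> r \<Longrightarrow> ennreal (3 / 2) \<le> r / 2"
proof -
  show 1: "r / 2 = \<infinity> \<longleftrightarrow> r = \<infinity>" by (cases r) (auto simp: ennreal_divide_numeral ennreal_top_divide)
  show 2: "enn2real (r / 2) = enn2real r / 2" by (cases r) (auto simp: ennreal_divide_numeral ennreal_top_divide)
  show "frac_sub (r / 2) (3 / 2) = frac_sub r 3"
    using 1 2 by (cases "enn2real r = 0") (auto simp: frac_sub_def field_simps)
  show "ennreal (3 / 2) \<le> r / 2" if "3 \<le> r"
    using that
  proof (cases r)
    case (real x)
    with that have "3 / 2 \<le> x / 2" by simp
    then have "ennreal (3 / 2) \<le> ennreal (x / 2)" by (rule ennreal_leI)
    then show ?thesis unfolding real ennreal_divide_numeral[OF real(1)] .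
  qed (simp add: ennreal_top_divide)
qed

text \<open>
  A non-integrable function has integral \<open>0\<close> by convention, which keeps the inequality true.
\<close>

lemma ennreal_lebesgue_integral_le:
  fixes f :: "'b \<Rightarrow> real"
  shows "ennreal (integral\<^sup>L M f) \<le> (\<integral>\<^sup>+z. ennreal (norm (f z)) \<partial>M)"
proof (cases "integrable M f")
  case True
  have "ennreal (integral\<^sup>L M f) \<le> ennreal (norm (integral\<^sup>L M f))"
    by (intro ennreal_leI) auto
  also have "\<dots> \<le> (\<integral>\<^sup>+z. ennreal (norm (f z)) \<partial>M)"
    by (rule integral_norm_bound_ennreal[OF True])
  finally show ?thesis .
qed (simp add: not_integrable_integral_eq)

text \<open>
  This splits the pressure term, leaving only pure powers of \<open>\<bar>u\<bar>\<close> and \<open>\<bar>p\<bar>\<close>.  The exponents \<open>3\<close> and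
  \<open>3/2\<close> scale alike, since \<open>u\<close> and \<open>p\<close> have integrability \<open>r\<close> and \<open>r/2\<close>.
\<close>

lemma mult_le_cube_add_powr:
  fixes a b :: real
  assumes "0 \<le> a" "0 \<le> b"
  shows "b * a \<le> a ^ 3 + b powr (3 / 2)"
proof -
  have "a * b \<le> a powr 3 / 3 + b powr (3 / 2) / (3 / 2)"
    using assms by (intro Youngs_inequality) auto
  also have "\<dots> \<le> a ^ 3 + b powr (3 / 2)"
    using assms by (intro add_mono) (auto simp: divide_le_eq)
  finally show ?thesis by (simp add: mult.commute)
qed

text \<open>
  The pointwise bound of the integrand in the energy balance, with \<open>d\<close> and \<open>w\<close> in the roles of the time
  derivative and the spatial gradient of a cutoff.
\<close>

lemma energy_flux_le:
  fixes v w :: "'a::euclidean_space" and \<pi> d :: real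
  assumes "\<bar>d\<bar> \<le> 64 / \<tau>" "norm w \<le> 64 / \<delta>" "0 < \<tau>" "0 < \<delta>"
  shows "\<bar>(norm v)\<^sup>2 / 2 * d + ((norm v)\<^sup>2 / 2 + \<pi>) * (v \<bullet> w)\<bar>
    \<le> 32 / \<tau> * (norm v)\<^sup>2 + 96 / \<delta> * ((norm v) ^ 3 + \<bar>\<pi>\<bar> powr (3 / 2))"
proof -
  have vw: "\<bar>v \<bullet> w\<bar> \<le> norm v * (64 / \<delta>)"
    using assms Cauchy_Schwarz_ineq2[of v w] by (meson mult_left_mono norm_ge_zero order_trans)
  have aux: "a / 2 + b \<le> 3 / 2 * (a + c)" if "b \<le> a + c" "0 \<le> c" for a b c :: real
    using that by (simp add: field_simps)
  have "\<bar>((norm v)\<^sup>2 / 2 + \<pi>) * (v \<bullet> w)\<bar> \<le> ((norm v)\<^sup>2 / 2 + \<bar>\<pi>\<bar>) * (norm v * (64 / \<delta>))"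
    unfolding abs_mult using vw by (intro mult_mono) (auto intro: order_trans[OF abs_triangle_ineq])
  also have "\<dots> = 64 / \<delta> * ((norm v) ^ 3 / 2 + \<bar>\<pi>\<bar> * norm v)"
    by (simp add: power2_eq_square power3_eq_cube algebra_simps add_divide_distrib)
  also have "\<dots> \<le> 64 / \<delta> * (3 / 2 * ((norm v) ^ 3 + \<bar>\<pi>\<bar> powr (3 / 2)))"
  proof (intro mult_left_mono)
    show "(norm v) ^ 3 / 2 + \<bar>\<pi>\<bar> * norm v \<le> 3 / 2 * ((norm v) ^ 3 + \<bar>\<pi>\<bar> powr (3 / 2))"
      using mult_le_cube_add_powr[OF norm_ge_zero abs_ge_zero, of \<pi> v] aux powr_ge_zero[of "\<bar>\<pi>\<bar>" "3 / 2"]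
      by blast
  qed (use assms in simp)
  also have "64 / \<delta> * (3 / 2 * ((norm v) ^ 3 + \<bar>\<pi>\<bar> powr (3 / 2)))
      = 96 / \<delta> * ((norm v) ^ 3 + \<bar>\<pi>\<bar> powr (3 / 2))"
    unfolding mult.assoc[symmetric] by simp
  finally have 1: "\<bar>((norm v)\<^sup>2 / 2 + \<pi>) * (v \<bullet> w)\<bar> \<le> 96 / \<delta> * ((norm v) ^ 3 + \<bar>\<pi>\<bar> powr (3 / 2))"
    .
  have "\<bar>(norm v)\<^sup>2 / 2 * d\<bar> \<le> (norm v)\<^sup>2 / 2 * (64 / \<tau>)"
    unfolding abs_mult using assms by (intro mult_mono) auto
  with 1 show ?thesis by simp
qed

text \<open>
  This is the step that uses the sign of the dissipation: a non-negative test function that is at least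
  \<open>1\<close> on the cylinder integrates to at least the measure of the cylinder.  Finiteness of Radon
  measures on compact sets makes the cutoff integrable.
\<close>

lemma emeasure_cylinder_le_integral_cutoff:
  assumes X: "X \<in> sets borel" and \<mu>: "radon_measure_on X \<mu>"
    and \<delta>: "0 < \<delta>" and box: "compactly_in (doubled_box \<delta> (\<delta> powr \<alpha>) c \<inter> X) X"
  shows "emeasure \<mu> (cylinder \<alpha> \<delta> c \<inter> X) \<le> ennreal (LINT z|\<mu>. cutoff \<delta> (\<delta> powr \<alpha>) c z)"
    and "cutoff \<delta> (\<delta> powr \<alpha>) c \<in> Ckc 1 X"
proof -
  let ?\<tau> = "\<delta> powr \<alpha>" let ?\<phi> = "cutoff \<delta> ?\<tau> c"
  have \<tau>: "0 < ?\<tau>" using \<delta> by simp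
  have sets: "sets \<mu> = sets (restrict_space borel X)" using \<mu> by (simp add: radon_measure_on_def)
  then have space: "space \<mu> = X" by (simp add: sets_eq_imp_space_eq[OF sets] space_restrict_space)
  define K where "K = closure (doubled_box \<delta> ?\<tau> c \<inter> X)"
  have K: "compact K" "K \<subseteq> X" using box by (simp_all add: K_def compactly_in_def)
  have supp: "{z \<in> X. ?\<phi> z \<noteq> 0} \<subseteq> doubled_box \<delta> ?\<tau> c \<inter> X"
    using cutoff_eq_0[OF \<delta> \<tau>] by blast
  then have cl: "closure {z \<in> X. ?\<phi> z \<noteq> 0} \<subseteq> K"
    unfolding K_def by (rule closure_mono)
  then have "K \<inter> closure {z \<in> X. ?\<phi> z \<noteq> 0} = closure {z \<in> X. ?\<phi> z \<noteq> 0}"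
    by (rule Int_absorb1)
  then have "compact (closure {z \<in> X. ?\<phi> z \<noteq> 0})"
    using compact_Int_closed[OF K(1) closed_closure, of "{z \<in> X. ?\<phi> z \<noteq> 0}"] by (simp only:)
  then show "?\<phi> \<in> Ckc 1 X" unfolding Ckc_def compactly_in_def
    by (intro CollectI conjI Ck_cutoff order_trans[OF cl K(2)])
  have Kmu[measurable]: "K \<in> sets \<mu>"
    unfolding sets using K X by (subst sets_restrict_space_iff) (auto intro: compact_imp_closed borel_closed)
  have "continuous_on UNIV ?\<phi>" unfolding cutoff_def[abs_def] divide_inverse by (intro continuous_intros)
  then have "?\<phi> \<in> borel_measurable borel" by (rule borel_measurable_continuous_onI)
  then have meas[measurable]: "?\<phi> \<in> borel_measurable \<mu>"
    unfolding measurable_cong_sets[OF sets refl] by (rule measurable_restrict_space1)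
  have int: "integrable \<mu> ?\<phi>"
  proof (rule integrableI_bounded_set[where A = K and B = 16])
    show "emeasure \<mu> K < \<infinity>" using \<mu> K unfolding radon_measure_on_def by blast
    \<comment> \<open>Each of the two profile factors is at most \<open>4\<close>.\<close>
    show "AE x in \<mu>. x \<in> K \<longrightarrow> norm (?\<phi> x) \<le> 16"
    proof (intro AE_I2 impI)
      fix z
      have "?\<phi> z \<le> 4 * 4"
        unfolding cutoff_def by (rule mult_mono) (simp_all add: bump_bounds)
      then show "norm (?\<phi> z) \<le> 16" using cutoff_nonneg[of \<delta> ?\<tau> c z] by simp
    qed
    show "AE x in \<mu>. x \<notin> K \<longrightarrow> ?\<phi> x = 0"
    proof (rule AE_I2, rule impI, rule ccontr)
      fix z assume "z \<in> space \<mu>" "z \<notin> K" "?\<phi> z \<noteq> 0"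
      then have "z \<in> doubled_box \<delta> ?\<tau> c \<inter> X"
        unfolding space by (intro subsetD[OF supp] CollectI conjI)
      then have "z \<in> K" unfolding K_def by (rule subsetD[OF closure_subset])
      with \<open>z \<notin> K\<close> show False by simp
    qed
  qed (rule Kmu meas)+
  have "cylinder \<alpha> \<delta> c \<in> sets borel"
    unfolding cylinder_def by (intro borel_Times) auto
  then have [measurable]: "cylinder \<alpha> \<delta> c \<inter> X \<in> sets \<mu>"
    unfolding sets using X by (subst sets_restrict_space_iff) auto
  have "emeasure \<mu> (cylinder \<alpha> \<delta> c \<inter> X) = (\<integral>\<^sup>+z. indicator (cylinder \<alpha> \<delta> c \<inter> X) z \<partial>\<mu>)"
    by (rule nn_integral_indicator[symmetric]) measurable
  also have "\<dots> \<le> (\<integral>\<^sup>+z. ennreal (?\<phi> z) \<partial>\<mu>)"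
  proof (rule nn_integral_mono)
    fix z
    have "1 \<le> ?\<phi> z" if "z \<in> cylinder \<alpha> \<delta> c"
      using that by (intro cutoff_ge_1) (auto simp: cylinder_def dist_norm norm_minus_commute)
    then show "indicator (cylinder \<alpha> \<delta> c \<inter> X) z \<le> ennreal (?\<phi> z)"
      by (cases "z \<in> cylinder \<alpha> \<delta> c \<inter> X") (auto simp: indicator_simps)
  qed
  also have "\<dots> = ennreal (LINT z|\<mu>. ?\<phi> z)"
    by (rule nn_integral_eq_integral[OF int]) (simp add: cutoff_nonneg)
  finally show "emeasure \<mu> (cylinder \<alpha> \<delta> c \<inter> X) \<le> ennreal (LINT z|\<mu>. ?\<phi> z)" .
qed

text \<open>
  The bound on the dissipation of one cylinder, before the powers of \<open>\<delta>\<close> are collected.  Here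
  \<open>W \<times> J\<close> is any product set on which the mixed norms are finite and that contains the part of the doubled
  box inside the fluid domain; \<open>V\<close> is the volume of the doubled ball and \<open>L\<close> the length of
  the doubled time interval.
\<close>

lemma emeasure_cylinder_le_mixed_norms:
  fixes \<Omega> W :: "'a::euclidean_space set" and u :: "'a \<times> real \<Rightarrow> 'a" and p :: "'a \<times> real \<Rightarrow> real"
  assumes X: "X \<in> sets borel" and \<mu>: "radon_measure_on X \<mu>" and eb: "energy_balance \<Omega> T u p X \<mu>"
    and W: "W \<in> sets borel" and J: "J \<in> sets borel"
    and u: "in_LL q r J W u" and p: "in_LL (q / 2) (r / 2) J W p"
    and rq: "3 \<le> r" "3 \<le> q"
    and \<delta>: "0 < \<delta>" and box: "compactly_in (doubled_box \<delta> (\<delta> powr \<alpha>) c \<inter> X) X"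
    and sub: "doubled_box \<delta> (\<delta> powr \<alpha>) c \<inter> \<Omega> \<times> {0<..<T} \<subseteq> W \<times> J"
  defines "gu \<equiv> \<lambda>z. ennreal (norm (u z)) * indicator (W \<times> J) z"
    and "gp \<equiv> \<lambda>z. ennreal (norm (p z)) * indicator (W \<times> J) z"
    and "V \<equiv> unit_ball_vol (real DIM('a)) * (2 * \<delta>) ^ DIM('a)" and "L \<equiv> 4 * \<delta> powr \<alpha>"
    and "I \<equiv> ball (snd c) (2 * \<delta> powr \<alpha>)"
  shows "emeasure \<mu> (cylinder \<alpha> \<delta> c \<inter> X)
    \<le> ennreal (32 / \<delta> powr \<alpha> * (V powr frac_sub r 2 * L powr frac_sub q 2)) *
        ennreal_powr (Lnorm q lborel (\<lambda>t. Lnorm r lborel (\<lambda>x. gu (x, t)) * indicator I t)) 2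
    + ennreal (96 / \<delta> * (V powr frac_sub r 3 * L powr frac_sub q 3)) *
        (ennreal_powr (Lnorm q lborel (\<lambda>t. Lnorm r lborel (\<lambda>x. gu (x, t)) * indicator I t)) 3
       + ennreal_powr (Lnorm (q / 2) lborel (\<lambda>t. Lnorm (r / 2) lborel (\<lambda>x. gp (x, t)) * indicator I t)) (3 / 2))"
proof -
  let ?\<tau> = "\<delta> powr \<alpha>" let ?\<phi> = "cutoff \<delta> ?\<tau> c" let ?D = "\<Omega> \<times> {0<..<T}"
  let ?A = "ball (fst c) (2 * \<delta>)"
  have \<tau>: "0 < ?\<tau>" using \<delta> by simp
  have [measurable]: "gu \<in> borel_measurable borel" "gp \<in> borel_measurable borel"
    unfolding gu_def gp_def using in_LL_zero_extension(1)[OF u W J] in_LL_zero_extension(1)[OF p W J] by simp_all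
  have AI: "doubled_box \<delta> ?\<tau> c = ?A \<times> I" by (simp add: doubled_box_def I_def)
  have [measurable]: "?A \<times> I \<in> sets borel" unfolding I_def by (intro borel_Times) auto
  define f where "f z = (norm (u z))\<^sup>2 / 2 * dt ?\<phi> z + ((norm (u z))\<^sup>2 / 2 + p z) * (u z \<bullet> grad_x ?\<phi> z)" for z
  have "emeasure \<mu> (cylinder \<alpha> \<delta> c \<inter> X) \<le> ennreal (LINT z|\<mu>. ?\<phi> z)"
    by (rule emeasure_cylinder_le_integral_cutoff(1)[OF X \<mu> \<delta> box])
  also have "(LINT z|\<mu>. ?\<phi> z) = (LINT z:?D|lborel. f z)"
    using eb emeasure_cylinder_le_integral_cutoff(2)[OF X \<mu> \<delta> box]
    by (simp add: energy_balance_def f_def)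
  also have "ennreal \<dots> \<le> (\<integral>\<^sup>+z. ennreal (norm (indicator ?D z *\<^sub>R f z)) \<partial>lborel)"
    unfolding set_lebesgue_integral_def by (rule ennreal_lebesgue_integral_le)
  also have "\<dots> \<le> (\<integral>\<^sup>+z. ennreal (32 / ?\<tau>) * (ennreal_powr (gu z) 2 * indicator (?A \<times> I) z)
      + ennreal (96 / \<delta>) * (ennreal_powr (gu z) 3 * indicator (?A \<times> I) z
         + ennreal_powr (gp z) (3 / 2) * indicator (?A \<times> I) z) \<partial>lborel)"
  proof (rule nn_integral_mono)
    fix z :: "'a \<times> real"
    have d: "\<bar>dt ?\<phi> z\<bar> \<le> 64 / ?\<tau> * indicator (?A \<times> I) z"
      and g: "norm (grad_x ?\<phi> z) \<le> 64 / \<delta> * indicator (?A \<times> I) z"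
      unfolding AI[symmetric] by (rule dt_cutoff_le[OF \<delta> \<tau>], rule grad_x_cutoff_le[OF \<delta> \<tau>])
    \<comment> \<open>Both derivatives of the cutoff vanish off the doubled box; inside the domain the box lies in \<open>W \<times> J\<close>,
        where the zero extensions agree with \<open>u\<close> and \<open>p\<close>.\<close>
    consider "z \<notin> ?D" | "z \<notin> ?A \<times> I" | "z \<in> ?D" "z \<in> ?A \<times> I" "z \<in> W \<times> J"
      using sub unfolding AI by blast
    then show "ennreal (norm (indicator ?D z *\<^sub>R f z)) \<le>
      ennreal (32 / ?\<tau>) * (ennreal_powr (gu z) 2 * indicator (?A \<times> I) z)
      + ennreal (96 / \<delta>) * (ennreal_powr (gu z) 3 * indicator (?A \<times> I) z
         + ennreal_powr (gp z) (3 / 2) * indicator (?A \<times> I) z)"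
    proof cases
      case 2
      then have "f z = 0" using d g by (simp add: f_def)
      then show ?thesis by simp
    next
      case 3
      have "\<bar>f z\<bar> \<le> 32 / ?\<tau> * (norm (u z))\<^sup>2 + 96 / \<delta> * ((norm (u z)) ^ 3 + \<bar>p z\<bar> powr (3 / 2))"
        unfolding f_def using d g 3(2) \<delta> \<tau> by (intro energy_flux_le) simp_all
      then have "ennreal \<bar>f z\<bar> \<le> ennreal (32 / ?\<tau> * (norm (u z))\<^sup>2 + 96 / \<delta> * ((norm (u z)) ^ 3 + \<bar>p z\<bar> powr (3 / 2)))"
        by (rule ennreal_leI)
      also have "\<dots> = ennreal (32 / ?\<tau>) * ennreal ((norm (u z))\<^sup>2)
          + ennreal (96 / \<delta>) * (ennreal ((norm (u z)) ^ 3) + ennreal (\<bar>p z\<bar> powr (3 / 2)))"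
        using \<delta> \<tau> by (simp add: ennreal_mult' ennreal_plus del: times_divide_eq_left)
      finally show ?thesis using 3 by (simp add: gu_def gp_def)
    qed simp
  qed
  also have "\<dots> = ennreal (32 / ?\<tau>) * (\<integral>\<^sup>+z\<in>?A \<times> I. ennreal_powr (gu z) 2 \<partial>lborel)
      + ennreal (96 / \<delta>) * ((\<integral>\<^sup>+z\<in>?A \<times> I. ennreal_powr (gu z) 3 \<partial>lborel)
         + (\<integral>\<^sup>+z\<in>?A \<times> I. ennreal_powr (gp z) (3 / 2) \<partial>lborel))"
    by (simp add: nn_integral_add nn_integral_cmult)
  also have "\<dots> \<le> ennreal (32 / ?\<tau>) * (ennreal (V powr frac_sub r 2 * L powr frac_sub q 2) *
        ennreal_powr (Lnorm q lborel (\<lambda>t. Lnorm r lborel (\<lambda>x. gu (x, t)) * indicator I t)) 2)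
    + ennreal (96 / \<delta>) * (ennreal (V powr frac_sub r 3 * L powr frac_sub q 3) *
        ennreal_powr (Lnorm q lborel (\<lambda>t. Lnorm r lborel (\<lambda>x. gu (x, t)) * indicator I t)) 3
       + ennreal (V powr frac_sub (r / 2) (3 / 2) * L powr frac_sub (q / 2) (3 / 2)) *
        ennreal_powr (Lnorm (q / 2) lborel (\<lambda>t. Lnorm (r / 2) lborel (\<lambda>x. gp (x, t)) * indicator I t)) (3 / 2))"
  proof -
    have V: "emeasure lborel ?A \<le> ennreal V" "0 < V"
      using \<delta> by (simp_all add: V_def emeasure_ball)
    have L: "emeasure lborel I \<le> ennreal L" "0 < L"
      using \<tau> by (simp_all add: L_def I_def ball_eq_greaterThanLessThan)
    have "ennreal 2 \<le> 3" by simp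
    then have 2: "ennreal 2 \<le> r" "ennreal 2 \<le> q" using rq by (blast intro: order_trans)+
    have "ennreal 3 = 3" by simp
    then have 3: "ennreal 3 \<le> r" "ennreal 3 \<le> q" using rq by simp_all
    note est = nn_integral_powr_cylinder_le[where A = ?A and I = I, OF _ _ _ V L]
    show ?thesis
      by (intro add_mono mult_left_mono est)
        (use 2 3 rq in \<open>simp_all add: I_def ennreal_half_exponent(4)\<close>)
  qed
  also have "\<dots> = ennreal (32 / ?\<tau> * (V powr frac_sub r 2 * L powr frac_sub q 2)) *
        ennreal_powr (Lnorm q lborel (\<lambda>t. Lnorm r lborel (\<lambda>x. gu (x, t)) * indicator I t)) 2
    + ennreal (96 / \<delta> * (V powr frac_sub r 3 * L powr frac_sub q 3)) *
        (ennreal_powr (Lnorm q lborel (\<lambda>t. Lnorm r lborel (\<lambda>x. gu (x, t)) * indicator I t)) 3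
       + ennreal_powr (Lnorm (q / 2) lborel (\<lambda>t. Lnorm (r / 2) lborel (\<lambda>x. gp (x, t)) * indicator I t)) (3 / 2))"
  proof -
    have c: "0 \<le> 32 / ?\<tau>" "0 \<le> 96 / \<delta>" using \<delta> by simp_all
    show ?thesis
      by (simp only: ennreal_half_exponent(3) ennreal_mult'[OF c(1)] ennreal_mult'[OF c(2)] distrib_left mult.assoc)
  qed
  finally show ?thesis .
qed

text \<open>
  Counting powers of \<open>\<delta>\<close>: the first expression is a constant times
  \<open>\<delta> powr (d (r-2)/r - 2\<alpha>/q)\<close>, because \<open>\<alpha> (q-2)/q - \<alpha> = - 2\<alpha>/q\<close>, and the second is a
  constant times \<open>\<delta> powr (d (r-3)/r - 1 + \<alpha> (q-3)/q)\<close>.  For \<open>\<delta> \<le> 1\<close> the smaller exponent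
  gives the larger power.
\<close>

lemma crit_exponent_scaling:
  assumes s: "s = crit_exponent d \<alpha> q r" and v: "0 < v" and q: "3 \<le> q"
  shows "\<exists>K>0. \<forall>\<delta>. 0 < \<delta> \<longrightarrow> \<delta> \<le> 1 \<longrightarrow>
     32 / \<delta> powr \<alpha> * ((v * (2 * \<delta>) ^ d) powr frac_sub r 2 * (4 * \<delta> powr \<alpha>) powr frac_sub q 2) \<le> K * \<delta> powr s \<and>
     96 / \<delta> * ((v * (2 * \<delta>) ^ d) powr frac_sub r 3 * (4 * \<delta> powr \<alpha>) powr frac_sub q 3) \<le> K * \<delta> powr s"
proof -
  define w where "w = v * 2 ^ d"
  have w: "0 < w" using v by (simp add: w_def)
  define K2 where "K2 = 32 * (w powr frac_sub r 2 * 4 powr frac_sub q 2)"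
  define K3 where "K3 = 96 * (w powr frac_sub r 3 * 4 powr frac_sub q 3)"
  have K: "0 < K2" "0 < K3" using w by (simp_all add: K2_def K3_def)
  have split: "(v * (2 * \<delta>) ^ d) powr a * (4 * \<delta> powr \<alpha>) powr b = w powr a * 4 powr b * \<delta> powr (d * a + \<alpha> * b)"
    if "0 < \<delta>" for \<delta> a b :: real
  proof -
    have "v * (2 * \<delta>) ^ d = w * \<delta> powr d"
      using that by (simp add: w_def power_mult_distrib powr_realpow)
    then show ?thesis using w that by (simp only: powr_mult powr_powr powr_add) (simp add: ac_simps)
  qed
  show ?thesis
  proof (intro exI[of _ "max K2 K3"] conjI allI impI)
    show "0 < max K2 K3" using K by simp
    fix \<delta> :: real assume \<delta>: "0 < \<delta>" "\<delta> \<le> 1"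
    have "32 / \<delta> powr \<alpha> * ((v * (2 * \<delta>) ^ d) powr frac_sub r 2 * (4 * \<delta> powr \<alpha>) powr frac_sub q 2)
        = K2 * \<delta> powr (d * frac_sub r 2 + \<alpha> * frac_sub q 2 - \<alpha>)"
      using \<delta> by (simp only: split K2_def powr_diff) simp
    also have "\<dots> \<le> max K2 K3 * \<delta> powr s"
    proof (intro mult_mono)
      have "s \<le> d * frac_sub r 2 - \<alpha> * frac_two q" using s by (simp add: crit_exponent_def)
      also have "frac_two q = 1 - frac_sub q 2"
      proof (cases "q = \<infinity>")
        case False
        then have "enn2real q \<noteq> 0" using q by (auto simp: enn2real_eq_0_iff)
        then show ?thesis using False by (simp add: frac_two_def frac_sub_def field_simps)
      qed (simp add: frac_two_def frac_sub_def)
      finally show "\<delta> powr (d * frac_sub r 2 + \<alpha> * frac_sub q 2 - \<alpha>) \<le> \<delta> powr s"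
        using \<delta> by (intro powr_mono') (auto simp: algebra_simps)
    qed (use K in auto)
    finally show "32 / \<delta> powr \<alpha> * ((v * (2 * \<delta>) ^ d) powr frac_sub r 2 * (4 * \<delta> powr \<alpha>) powr frac_sub q 2)
        \<le> max K2 K3 * \<delta> powr s" .
    have "96 / \<delta> * ((v * (2 * \<delta>) ^ d) powr frac_sub r 3 * (4 * \<delta> powr \<alpha>) powr frac_sub q 3)
        = K3 * \<delta> powr (d * frac_sub r 3 + \<alpha> * frac_sub q 3 - 1)"
      using \<delta> by (simp only: split K3_def powr_diff) simp
    also have "\<dots> \<le> max K2 K3 * \<delta> powr s"
    proof (intro mult_mono)
      have "s \<le> d * frac_sub r 3 - 1 + \<alpha> * frac_sub q 3" using s by (simp add: crit_exponent_def)
      then show "\<delta> powr (d * frac_sub r 3 + \<alpha> * frac_sub q 3 - 1) \<le> \<delta> powr s"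
        using \<delta> by (intro powr_mono') auto
    qed (use K in auto)
    finally show "96 / \<delta> * ((v * (2 * \<delta>) ^ d) powr frac_sub r 3 * (4 * \<delta> powr \<alpha>) powr frac_sub q 3)
        \<le> max K2 K3 * \<delta> powr s" .
  qed
qed

section \<open>The anisotropic Hausdorff measure\<close>

text \<open>
  Covers are restricted by the diameter of their cylinders, while the dissipation estimate needs small radii.
  Two points of the cylinder at distance \<open>\<delta>/2\<close> suffice for the comparison.
\<close>

lemma cylinder_radius_le:
  fixes c :: "'a::euclidean_space \<times> real"
  assumes \<delta>: "0 < \<delta>" and d: "diameter (cylinder \<alpha> \<delta> c) \<le> \<rho>"
  shows "\<delta> \<le> 2 * \<rho>"
proof -
  obtain b :: 'a where b: "b \<in> Basis" using nonempty_Basis by blast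
  have "bounded (cylinder \<alpha> \<delta> c)"
    unfolding cylinder_def by (intro bounded_Times) auto
  moreover have "c \<in> cylinder \<alpha> \<delta> c" "c + ((\<delta> / 2) *\<^sub>R b, 0) \<in> cylinder \<alpha> \<delta> c"
    using \<delta> b by (auto simp: cylinder_def dist_norm mem_Times_iff)
  ultimately have "dist (c + ((\<delta> / 2) *\<^sub>R b, 0)) c \<le> diameter (cylinder \<alpha> \<delta> c)"
    using diameter_bounded_bound by blast
  moreover have "dist (c + ((\<delta> / 2) *\<^sub>R b, 0)) c = \<delta> / 2"
    using \<delta> b by (simp add: dist_norm norm_Pair)
  ultimately show ?thesis using d by simp
qed

lemma hausdorff_pre_antimono_radius:
  assumes "\<rho> \<le> \<rho>'"
  shows "hausdorff_pre \<alpha> s \<rho>' A \<le> hausdorff_pre \<alpha> s \<rho> A"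
  unfolding hausdorff_pre_def
  by (intro Inf_superset_mono) (use assms in \<open>blast intro: order_trans\<close>)

lemma hausdorff_pre_mono:
  assumes "A \<subseteq> B"
  shows "hausdorff_pre \<alpha> s \<rho> A \<le> hausdorff_pre \<alpha> s \<rho> B"
  unfolding hausdorff_pre_def
  by (intro Inf_superset_mono) (use assms in \<open>blast intro: order_trans\<close>)

lemma hausdorff_pre_antimono_exponent:
  fixes A :: "('a::euclidean_space \<times> real) set"
  assumes s: "s' \<le> s" and \<rho>: "\<rho> \<le> 1 / 2"
  shows "hausdorff_pre \<alpha> s \<rho> A \<le> hausdorff_pre \<alpha> s' \<rho> A"
  unfolding hausdorff_pre_def
proof (rule Inf_greatest)
  fix y assume "y \<in> {(\<Sum>\<^sub>\<infinity>i\<in>I. ennreal (\<delta> i powr s')) | (I :: nat set) (c :: nat \<Rightarrow> 'a \<times> real) \<delta>.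
            (\<forall>i\<in>I. 0 < \<delta> i \<and> diameter (cylinder \<alpha> (\<delta> i) (c i)) \<le> \<rho>) \<and>
            A \<subseteq> (\<Union>i\<in>I. cylinder \<alpha> (\<delta> i) (c i))}"
  then obtain I :: "nat set" and c :: "nat \<Rightarrow> 'a \<times> real" and \<delta> where
    y: "y = (\<Sum>\<^sub>\<infinity>i\<in>I. ennreal (\<delta> i powr s'))"
    and I: "\<forall>i\<in>I. 0 < \<delta> i \<and> diameter (cylinder \<alpha> (\<delta> i) (c i)) \<le> \<rho>"
      "A \<subseteq> (\<Union>i\<in>I. cylinder \<alpha> (\<delta> i) (c i))" by blast
  have le1: "\<delta> i \<le> 1" if "i \<in> I" for i
    using cylinder_radius_le[of "\<delta> i" \<alpha> "c i" \<rho>] I that \<rho> by force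
  have "(\<Sum>\<^sub>\<infinity>i\<in>I. ennreal (\<delta> i powr s)) \<le> y"
    unfolding y
  proof (rule infsum_mono)
    show "ennreal (\<delta> i powr s) \<le> ennreal (\<delta> i powr s')" if "i \<in> I" for i
      using le1[OF that] I(1) that s by (intro ennreal_leI powr_mono') auto
  qed (auto intro: nonneg_summable_on_complete)
  then show "Inf {(\<Sum>\<^sub>\<infinity>i\<in>I. ennreal (\<delta> i powr s)) | (I :: nat set) (c :: nat \<Rightarrow> 'a \<times> real) \<delta>.
            (\<forall>i\<in>I. 0 < \<delta> i \<and> diameter (cylinder \<alpha> (\<delta> i) (c i)) \<le> \<rho>) \<and>
            A \<subseteq> (\<Union>i\<in>I. cylinder \<alpha> (\<delta> i) (c i))} \<le> y"
    by (rule Inf_lower2[rotated]) (use I in blast)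
qed

text \<open>
  Smaller admissible diameters leave fewer covers, so the limit defining the measure is a monotone
  limit; in particular it exists.
\<close>

lemma hausdorff_aniso_eq_SUP: "hausdorff_aniso \<alpha> s A = (SUP \<rho>\<in>{0<..}. hausdorff_pre \<alpha> s \<rho> A)"
proof -
  let ?S = "SUP \<rho>\<in>{0<..}. hausdorff_pre \<alpha> s \<rho> A"
  have "((\<lambda>\<rho>. hausdorff_pre \<alpha> s \<rho> A) \<longlongrightarrow> ?S) (at_right 0)"
  proof (rule order_tendstoI)
    fix a assume "a < ?S"
    then obtain \<rho> where \<rho>: "0 < \<rho>" "a < hausdorff_pre \<alpha> s \<rho> A" by (auto simp: less_SUP_iff)
    have "\<forall>\<^sub>F x in at_right 0. x < \<rho>"
      using \<rho>(1) by (auto simp: eventually_at_right_field)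
    then show "\<forall>\<^sub>F x in at_right 0. a < hausdorff_pre \<alpha> s x A"
      by eventually_elim (use \<rho>(2) hausdorff_pre_antimono_radius less_imp_le less_le_trans in blast)
  next
    fix a assume a: "?S < a"
    show "\<forall>\<^sub>F x in at_right 0. hausdorff_pre \<alpha> s x A < a"
      using eventually_at_right_less[of 0]
      by eventually_elim (rule le_less_trans[OF SUP_upper a], simp)
  qed
  then show ?thesis unfolding hausdorff_aniso_def by (intro tendsto_Lim) auto
qed

lemma hausdorff_pre_le_aniso: "0 < \<rho> \<Longrightarrow> hausdorff_pre \<alpha> s \<rho> A \<le> hausdorff_aniso \<alpha> s A"
  unfolding hausdorff_aniso_eq_SUP by (rule SUP_upper) simp

lemma hausdorff_aniso_mono: "A \<subseteq> B \<Longrightarrow> hausdorff_aniso \<alpha> s A \<le> hausdorff_aniso \<alpha> s B"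
  unfolding hausdorff_aniso_eq_SUP by (intro SUP_mono) (blast intro: hausdorff_pre_mono)

lemma hausdorff_aniso_antimono_exponent:
  assumes "s' \<le> s"
  shows "hausdorff_aniso \<alpha> s A \<le> hausdorff_aniso \<alpha> s' A"
  unfolding hausdorff_aniso_eq_SUP[of \<alpha> s]
proof (rule SUP_least)
  fix \<rho> :: real assume \<rho>: "\<rho> \<in> {0<..}"
  have "hausdorff_pre \<alpha> s \<rho> A \<le> hausdorff_pre \<alpha> s (min \<rho> (1 / 2)) A"
    by (rule hausdorff_pre_antimono_radius) simp
  also have "\<dots> \<le> hausdorff_pre \<alpha> s' (min \<rho> (1 / 2)) A"
    by (rule hausdorff_pre_antimono_exponent[OF assms]) simp
  also have "\<dots> \<le> hausdorff_aniso \<alpha> s' A"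
    using \<rho> by (intro hausdorff_pre_le_aniso) auto
  finally show "hausdorff_pre \<alpha> s \<rho> A \<le> hausdorff_aniso \<alpha> s' A" .
qed

lemma infsum_ennreal_eq_suminf:
  fixes f :: "nat \<Rightarrow> ennreal"
  shows "infsum f I = (\<Sum>i. if i \<in> I then f i else 0)"
proof -
  let ?g = "\<lambda>i. if i \<in> I then f i else 0"
  have "infsum f I = infsum ?g UNIV" by (rule infsum_cong_neutral) auto
  moreover have "?g sums infsum ?g UNIV"
    by (intro has_sum_imp_sums has_sum_infsum nonneg_summable_on_complete) auto
  ultimately show ?thesis by (simp add: sums_unique)
qed

text \<open>
  The covering argument.  Only cylinders that meet \<open>B\<close> are kept from a cover, which is why the bound
  \<open>cyl\<close> is required for those alone.
\<close>

lemma emeasure_le_hausdorff_aniso: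
  fixes B X :: "('a::euclidean_space \<times> real) set"
  assumes cyl: "\<And>c \<delta>. 0 < \<delta> \<Longrightarrow> \<delta> < \<delta>\<^sub>0 \<Longrightarrow> cylinder \<alpha> \<delta> c \<inter> B \<noteq> {} \<Longrightarrow>
      emeasure \<mu> (cylinder \<alpha> \<delta> c \<inter> X) \<le> E * ennreal (\<delta> powr s)"
    and meas: "\<And>c \<delta>. cylinder \<alpha> \<delta> c \<inter> X \<in> sets \<mu>"
    and BX: "B \<subseteq> X" and \<delta>\<^sub>0: "0 < \<delta>\<^sub>0" and h: "hausdorff_aniso \<alpha> s B < h"
  shows "emeasure \<mu> B \<le> E * h"
proof -
  \<comment> \<open>Diameter at most \<open>\<delta>\<^sub>0 / 3\<close> forces radius at most \<open>2 \<delta>\<^sub>0 / 3\<close>.\<close>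
  have "hausdorff_pre \<alpha> s (\<delta>\<^sub>0 / 3) B < h"
    using hausdorff_pre_le_aniso[of "\<delta>\<^sub>0 / 3" \<alpha> s B] h \<delta>\<^sub>0 by (simp add: le_less_trans)
  then obtain I :: "nat set" and c :: "nat \<Rightarrow> 'a \<times> real" and \<delta> where
    sum: "(\<Sum>\<^sub>\<infinity>i\<in>I. ennreal (\<delta> i powr s)) < h"
    and I: "\<forall>i\<in>I. 0 < \<delta> i \<and> diameter (cylinder \<alpha> (\<delta> i) (c i)) \<le> \<delta>\<^sub>0 / 3"
      "B \<subseteq> (\<Union>i\<in>I. cylinder \<alpha> (\<delta> i) (c i))"
    unfolding hausdorff_pre_def Inf_less_iff by blast
  define C where "C i = (if i \<in> I \<and> cylinder \<alpha> (\<delta> i) (c i) \<inter> B \<noteq> {} then cylinder \<alpha> (\<delta> i) (c i) \<inter> X else {})" for i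
  have C: "C i \<in> sets \<mu>" for i using meas by (simp add: C_def)
  have "emeasure \<mu> B \<le> emeasure \<mu> (\<Union>i. C i)"
  proof (rule emeasure_mono)
    show "B \<subseteq> (\<Union>i. C i)"
    proof
      fix z assume z: "z \<in> B"
      then obtain i where "i \<in> I" "z \<in> cylinder \<alpha> (\<delta> i) (c i)" using I by blast
      then have "z \<in> C i" using z BX by (auto simp: C_def)
      then show "z \<in> (\<Union>i. C i)" by blast
    qed
  qed (use C in auto)
  also have "\<dots> \<le> (\<Sum>i. emeasure \<mu> (C i))"
    by (rule emeasure_subadditive_countably) (use C in auto)
  also have "\<dots> \<le> (\<Sum>i. E * (if i \<in> I then ennreal (\<delta> i powr s) else 0))"
  proof (rule suminf_le)
    show "emeasure \<mu> (C i) \<le> E * (if i \<in> I then ennreal (\<delta> i powr s) else 0)" for i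
    proof (cases "i \<in> I \<and> cylinder \<alpha> (\<delta> i) (c i) \<inter> B \<noteq> {}")
      case True
      then have "\<delta> i \<le> 2 * (\<delta>\<^sub>0 / 3)" "0 < \<delta> i" using I cylinder_radius_le by blast+
      then have "emeasure \<mu> (cylinder \<alpha> (\<delta> i) (c i) \<inter> X) \<le> E * ennreal (\<delta> i powr s)"
        using True \<delta>\<^sub>0 by (intro cyl) auto
      then show ?thesis using True by (simp add: C_def)
    next
      case False
      then have "C i = {}" by (auto simp: C_def)
      then show ?thesis by simp
    qed
  qed auto
  also have "\<dots> = E * (\<Sum>\<^sub>\<infinity>i\<in>I. ennreal (\<delta> i powr s))"
    by (simp only: infsum_ennreal_eq_suminf ennreal_suminf_cmult)
  also have "\<dots> \<le> E * h" using sum by (intro mult_left_mono) auto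
  finally show ?thesis .
qed

section \<open>Vanishing of the dissipation on small sets\<close>

text \<open>
  The common core of the interior and the boundary case.  If \<open>a\<close> bounds the mixed norms over all short time
  intervals, the dissipation of \<open>B\<close> is at most \<open>K (a\<^sup>2 + a\<^sup>3 + a powr (3/2))\<close> times any number above
  the Hausdorff measure.  Either \<open>a\<close> can be made small, when \<open>q < \<infinity>\<close>, or the
  second factor can.
\<close>

lemma emeasure_eq_0_if_hausdorff_aniso:
  fixes \<Omega> W :: "'a::euclidean_space set" and u :: "'a \<times> real \<Rightarrow> 'a" and p :: "'a \<times> real \<Rightarrow> real"
  assumes X: "X \<in> sets borel" and \<mu>: "radon_measure_on X \<mu>" and eb: "energy_balance \<Omega> T u p X \<mu>"
    and W: "W \<in> sets borel" and J: "J \<in> sets borel"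
    and u: "in_LL q r J W u" and p: "in_LL (q / 2) (r / 2) J W p"
    and rq: "3 \<le> r" "3 \<le> q" and \<alpha>: "0 < \<alpha>" and s: "s = crit_exponent DIM('a) \<alpha> q r"
    and BX: "B \<subseteq> X" and \<delta>\<^sub>0: "0 < \<delta>\<^sub>0"
    and box: "\<And>c \<delta>. 0 < \<delta> \<Longrightarrow> \<delta> < \<delta>\<^sub>0 \<Longrightarrow> cylinder \<alpha> \<delta> c \<inter> B \<noteq> {} \<Longrightarrow>
       compactly_in (doubled_box \<delta> (\<delta> powr \<alpha>) c \<inter> X) X"
    and sub: "\<And>c \<delta>. 0 < \<delta> \<Longrightarrow> \<delta> < \<delta>\<^sub>0 \<Longrightarrow> cylinder \<alpha> \<delta> c \<inter> B \<noteq> {} \<Longrightarrow>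
       doubled_box \<delta> (\<delta> powr \<alpha>) c \<inter> \<Omega> \<times> {0<..<T} \<subseteq> W \<times> J"
    and H: "q < \<infinity> \<and> hausdorff_aniso \<alpha> s B < \<infinity> \<or> hausdorff_aniso \<alpha> s B = 0"
  shows "emeasure \<mu> B = 0"
proof -
  define gu where "gu = (\<lambda>z. ennreal (norm (u z)) * indicator (W \<times> J) z)"
  define gp where "gp = (\<lambda>z. ennreal (norm (p z)) * indicator (W \<times> J) z)"
  define Fu where "Fu t = Lnorm r lborel (\<lambda>x. gu (x, t))" for t
  define Fp where "Fp t = Lnorm (r / 2) lborel (\<lambda>x. gp (x, t))" for t
  have gu: "gu \<in> borel_measurable (lborel \<Otimes>\<^sub>M lborel)" and gp: "gp \<in> borel_measurable (lborel \<Otimes>\<^sub>M lborel)"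
    using in_LL_zero_extension(1)[OF u W J] in_LL_zero_extension(1)[OF p W J]
    by (simp_all add: gu_def gp_def lborel_prod)
  have Fu[measurable]: "Fu \<in> borel_measurable lborel" and Fp[measurable]: "Fp \<in> borel_measurable lborel"
    unfolding Fu_def[abs_def] Fp_def[abs_def]
    by (intro borel_measurable_Lnorm_slice sigma_finite_lborel gu gp)+
  have Lu: "Lnorm q lborel Fu < \<infinity>" and Lp: "Lnorm (q / 2) lborel Fp < \<infinity>"
    using in_LL_zero_extension(2)[OF u W J] in_LL_zero_extension(2)[OF p W J]
    by (simp_all add: Fu_def[abs_def] Fp_def[abs_def] gu_def gp_def)
  obtain K where K: "0 < K" and scale: "\<And>\<delta>. 0 < \<delta> \<Longrightarrow> \<delta> \<le> 1 \<Longrightarrow>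
     32 / \<delta> powr \<alpha> * ((unit_ball_vol (real DIM('a)) * (2 * \<delta>) ^ DIM('a)) powr frac_sub r 2 * (4 * \<delta> powr \<alpha>) powr frac_sub q 2) \<le> K * \<delta> powr s"
     "\<And>\<delta>. 0 < \<delta> \<Longrightarrow> \<delta> \<le> 1 \<Longrightarrow>
     96 / \<delta> * ((unit_ball_vol (real DIM('a)) * (2 * \<delta>) ^ DIM('a)) powr frac_sub r 3 * (4 * \<delta> powr \<alpha>) powr frac_sub q 3) \<le> K * \<delta> powr s"
    using crit_exponent_scaling[OF s, of "unit_ball_vol (real DIM('a))"] rq by auto
  have meas: "cylinder \<alpha> \<delta> c \<inter> X \<in> sets \<mu>" for c \<delta>
  proof -
    have "cylinder \<alpha> \<delta> c \<in> sets borel" unfolding cylinder_def by (intro borel_Times) auto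
    moreover have "sets \<mu> = sets (restrict_space borel X)" using \<mu> by (simp only: radon_measure_on_def)
    ultimately show ?thesis using X by (simp add: sets_restrict_space_iff)
  qed
  have key: "emeasure \<mu> B \<le> ennreal (K * (a\<^sup>2 + (a ^ 3 + a powr (3 / 2)))) * h"
    if a: "0 \<le> a" and l: "0 < l"
      and small: "\<And>I. I \<in> sets borel \<Longrightarrow> emeasure lborel I \<le> ennreal l \<Longrightarrow>
         Lnorm q lborel (\<lambda>t. Fu t * indicator I t) \<le> ennreal a \<and>
         Lnorm (q / 2) lborel (\<lambda>t. Fp t * indicator I t) \<le> ennreal a"
      and h: "hausdorff_aniso \<alpha> s B < h" for a l h
  proof (rule emeasure_le_hausdorff_aniso[OF _ meas BX _ h])
    \<comment> \<open>Radii so small that the doubled time interval, of length \<open>4 \<delta>\<^sup>\<alpha>\<close>, is shorter than \<open>l\<close>.\<close>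
    define \<delta>\<^sub>1 where "\<delta>\<^sub>1 = min \<delta>\<^sub>0 (min 1 ((l / 4) powr (1 / \<alpha>)))"
    show "0 < \<delta>\<^sub>1" using \<delta>\<^sub>0 l by (simp add: \<delta>\<^sub>1_def)
    fix c \<delta> assume \<delta>: "0 < \<delta>" "\<delta> < \<delta>\<^sub>1" and ne: "cylinder \<alpha> \<delta> c \<inter> B \<noteq> {}"
    have d: "\<delta> < \<delta>\<^sub>0" "\<delta> \<le> 1" using \<delta> by (auto simp: \<delta>\<^sub>1_def)
    let ?I = "ball (snd c) (2 * \<delta> powr \<alpha>)"
    have "\<delta> powr \<alpha> \<le> ((l / 4) powr (1 / \<alpha>)) powr \<alpha>"
      using \<delta> \<alpha> by (intro powr_mono2) (auto simp: \<delta>\<^sub>1_def)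
    also have "\<dots> = l / 4" using \<alpha> l by (simp add: powr_powr)
    finally have "emeasure lborel ?I \<le> ennreal l"
      by (simp add: ball_eq_greaterThanLessThan ennreal_leI)
    then have Nu: "Lnorm q lborel (\<lambda>t. Fu t * indicator ?I t) \<le> ennreal a"
      and Np: "Lnorm (q / 2) lborel (\<lambda>t. Fp t * indicator ?I t) \<le> ennreal a"
      using small[of ?I] by auto
    have P2: "ennreal_powr (Lnorm q lborel (\<lambda>t. Fu t * indicator ?I t)) 2 \<le> ennreal (a\<^sup>2)"
      and P3: "ennreal_powr (Lnorm q lborel (\<lambda>t. Fu t * indicator ?I t)) 3 \<le> ennreal (a ^ 3)"
      and PP: "ennreal_powr (Lnorm (q / 2) lborel (\<lambda>t. Fp t * indicator ?I t)) (3 / 2) \<le> ennreal (a powr (3 / 2))"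
      using ennreal_powr_mono[OF Nu, of 2] ennreal_powr_mono[OF Nu, of 3] ennreal_powr_mono[OF Np, of "3 / 2"] a
      by simp_all
    have "emeasure \<mu> (cylinder \<alpha> \<delta> c \<inter> X) \<le> ennreal (K * \<delta> powr s) * ennreal (a\<^sup>2)
        + ennreal (K * \<delta> powr s) * (ennreal (a ^ 3) + ennreal (a powr (3 / 2)))"
      by (rule order_trans[OF emeasure_cylinder_le_mixed_norms[OF X \<mu> eb W J u p rq \<delta>(1)
            box[OF \<delta>(1) d(1) ne] sub[OF \<delta>(1) d(1) ne]]])
        (intro add_mono mult_mono ennreal_leI scale \<delta>(1) d(2) P2[unfolded Fu_def gu_def]
          P3[unfolded Fu_def gu_def] PP[unfolded Fp_def gp_def], auto)
    also have "\<dots> = ennreal (K * \<delta> powr s * (a\<^sup>2 + (a ^ 3 + a powr (3 / 2))))"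
      using K a by (simp add: ennreal_mult' distrib_left)
    also have "\<dots> = ennreal (K * (a\<^sup>2 + (a ^ 3 + a powr (3 / 2)))) * ennreal (\<delta> powr s)"
      using K a by (subst ennreal_mult'[symmetric]) (auto simp: ac_simps)
    finally show "emeasure \<mu> (cylinder \<alpha> \<delta> c \<inter> X) \<le> ennreal (K * (a\<^sup>2 + (a ^ 3 + a powr (3 / 2)))) * ennreal (\<delta> powr s)" .
  qed
  have "emeasure \<mu> B \<le> 0"
  proof (rule ennreal_le_epsilon)
    fix e :: real assume e: "0 < e"
    show "emeasure \<mu> B \<le> 0 + ennreal e"
      using H
    proof
      assume q: "q < \<infinity> \<and> hausdorff_aniso \<alpha> s B < \<infinity>"
      then obtain h where h: "0 \<le> h" "hausdorff_aniso \<alpha> s B = ennreal h"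
        by (cases "hausdorff_aniso \<alpha> s B") auto
      \<comment> \<open>For \<open>a \<le> 1\<close> each of the three powers of \<open>a\<close> is at most \<open>a\<close>.\<close>
      define a where "a = min 1 (e / (3 * K * (h + 1)))"
      have a: "0 < a" "a \<le> 1" "3 * K * (h + 1) * a \<le> e"
      proof -
        have D: "0 < 3 * K * (h + 1)" using K h by simp
        show "0 < a" using divide_pos_pos[OF e D] by (simp only: a_def min_less_iff_conj) simp
        show "a \<le> 1" by (simp add: a_def)
        have "3 * K * (h + 1) * a \<le> 3 * K * (h + 1) * (e / (3 * K * (h + 1)))"
          using D by (intro mult_left_mono) (auto simp: a_def)
        also have "\<dots> = e" using K h by auto
        finally show "3 * K * (h + 1) * a \<le> e" .
      qed
      have pos: "0 < q" "0 < q / 2"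
        by (rule less_le_trans[OF _ rq(2)], simp)
          (rule less_le_trans[OF _ ennreal_half_exponent(4)[OF rq(2)]], simp)
      have fin: "q < \<infinity>" "q / 2 < \<infinity>"
        using q ennreal_half_exponent(1)[of q] by (auto simp: less_top[symmetric])
      obtain l1 l2 where l: "l1 > 0" "l2 > 0"
        "\<And>I. I \<in> sets lborel \<Longrightarrow> emeasure lborel I \<le> ennreal l1 \<Longrightarrow> Lnorm q lborel (\<lambda>t. Fu t * indicator I t) \<le> ennreal a"
        "\<And>I. I \<in> sets lborel \<Longrightarrow> emeasure lborel I \<le> ennreal l2 \<Longrightarrow> Lnorm (q / 2) lborel (\<lambda>t. Fp t * indicator I t) \<le> ennreal a"
        using Lnorm_indicator_small[OF Fu pos(1) fin(1) Lu a(1)] Lnorm_indicator_small[OF Fp pos(2) fin(2) Lp a(1)] by blast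
      have "emeasure \<mu> B \<le> ennreal (K * (a\<^sup>2 + (a ^ 3 + a powr (3 / 2)))) * ennreal (h + 1)"
      proof (rule key[of a "min l1 l2"])
        show "hausdorff_aniso \<alpha> s B < ennreal (h + 1)" using h by (simp add: ennreal_less_iff)
        show "Lnorm q lborel (\<lambda>t. Fu t * indicator I t) \<le> ennreal a \<and>
         Lnorm (q / 2) lborel (\<lambda>t. Fp t * indicator I t) \<le> ennreal a"
          if "I \<in> sets borel" "emeasure lborel I \<le> ennreal (min l1 l2)" for I
          using that l(3,4)[of I] order_trans[OF that(2) ennreal_leI] by auto
      qed (use a l in auto)
      also have "\<dots> = ennreal (K * (a\<^sup>2 + (a ^ 3 + a powr (3 / 2))) * (h + 1))"
        using h by (intro ennreal_mult''[symmetric]) simp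
      also have "\<dots> \<le> ennreal e"
      proof (rule ennreal_leI)
        have "a\<^sup>2 \<le> a" "a ^ 3 \<le> a"
          using a power_decreasing[of 1 2 a] power_decreasing[of 1 3 a] by auto
        moreover have "a powr (3 / 2) \<le> a"
          using a powr_mono'[of 1 "3 / 2" a] by simp
        ultimately have "K * (a\<^sup>2 + (a ^ 3 + a powr (3 / 2))) * (h + 1) \<le> K * (3 * a) * (h + 1)"
          using K h by (intro mult_right_mono mult_left_mono) auto
        also have "\<dots> \<le> e" using a(3) by (simp add: ac_simps)
        finally show "K * (a\<^sup>2 + (a ^ 3 + a powr (3 / 2))) * (h + 1) \<le> e" .
      qed
      finally show ?thesis by simp
    next
      assume h0: "hausdorff_aniso \<alpha> s B = 0"
      obtain a1 a2 where a12: "0 \<le> a1" "Lnorm q lborel Fu = ennreal a1"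
          "0 \<le> a2" "Lnorm (q / 2) lborel Fp = ennreal a2"
        using Lu Lp less_top_ennreal by (metis infinity_ennreal_def)
      define a where "a = max a1 a2"
      have a: "0 \<le> a" "Lnorm q lborel Fu \<le> ennreal a" "Lnorm (q / 2) lborel Fp \<le> ennreal a"
        using a12 by (auto simp: a_def intro!: ennreal_leI)
      define E where "E = K * (a\<^sup>2 + (a ^ 3 + a powr (3 / 2)))"
      have E: "0 \<le> E" using K a by (auto simp: E_def)
      have "emeasure \<mu> B \<le> ennreal E * ennreal (e / (E + 1))"
        unfolding E_def
      proof (rule key[of a 1])
        show "hausdorff_aniso \<alpha> s B < ennreal (e / (K * (a\<^sup>2 + (a ^ 3 + a powr (3 / 2))) + 1))"
          using E e h0 by (simp add: E_def)
        show "Lnorm q lborel (\<lambda>t. Fu t * indicator I t) \<le> ennreal a \<and>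
         Lnorm (q / 2) lborel (\<lambda>t. Fp t * indicator I t) \<le> ennreal a" if "I \<in> sets borel" for I
          using a(2,3) that Lnorm_mono_indicator[OF Fu, of I q] Lnorm_mono_indicator[OF Fp, of I "q / 2"]
          by (auto intro: order_trans)
      qed (use a in auto)
      also have "\<dots> \<le> ennreal e"
        using E e by (auto simp: ennreal_mult''[symmetric] field_simps intro!: ennreal_leI)
      finally show ?thesis by simp
    qed
  qed
  then show ?thesis by simp
qed

lemma compactly_in_subset_compact:
  fixes A X :: "'b::t2_space set"
  assumes "A \<subseteq> C" "compact C" "C \<subseteq> X"
  shows "compactly_in A X"
proof -
  have cl: "closure A \<subseteq> C" using assms by (intro closure_minimal compact_imp_closed)
  then have "C \<inter> closure A = closure A" by (rule Int_absorb1)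
  then have "compact (closure A)"
    using compact_Int_closed[OF assms(2) closed_closure, of A] by (simp only:)
  then show ?thesis unfolding compactly_in_def using order_trans[OF cl assms(3)] by (rule conjI)
qed

lemma obtain_radius_with_small_powr:
  fixes \<alpha> e :: real
  assumes "0 < \<alpha>" "0 < e"
  obtains \<delta>\<^sub>0 where "0 < \<delta>\<^sub>0" "\<And>\<delta>. 0 < \<delta> \<Longrightarrow> \<delta> < \<delta>\<^sub>0 \<Longrightarrow> \<delta> < e \<and> \<delta> powr \<alpha> < e"
proof
  show "0 < min e (e powr (1 / \<alpha>))" using assms by simp
  fix \<delta> assume \<delta>: "0 < \<delta>" "\<delta> < min e (e powr (1 / \<alpha>))"
  have "\<delta> powr \<alpha> < (e powr (1 / \<alpha>)) powr \<alpha>"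
    using \<delta> assms by (intro powr_less_mono2) auto
  with \<delta> assms show "\<delta> < e \<and> \<delta> powr \<alpha> < e" by (simp add: powr_powr)
qed

text \<open>
  The factor is \<open>3 = 2 + 1\<close>: one passes from \<open>z\<close> to the centre and on to \<open>b\<close>.
\<close>

lemma doubled_box_near_cylinder_point:
  assumes "z \<in> doubled_box \<delta> (\<delta> powr \<alpha>) c" "b \<in> cylinder \<alpha> \<delta> c"
  shows "dist (fst b) (fst z) \<le> 3 * \<delta>" "\<bar>snd z - snd b\<bar> \<le> 3 * \<delta> powr \<alpha>"
proof -
  have "dist (fst c) (fst z) < 2 * \<delta>" "dist (fst c) (fst b) < \<delta>"
    using assms by (auto simp: doubled_box_def cylinder_def)
  then show "dist (fst b) (fst z) \<le> 3 * \<delta>"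
    using dist_triangle3[of "fst b" "fst z" "fst c"] by (simp add: dist_commute)
  have "\<bar>snd c - snd z\<bar> < 2 * \<delta> powr \<alpha>" "snd c - \<delta> powr \<alpha> < snd b" "snd b < snd c + \<delta> powr \<alpha>"
    using assms by (auto simp: doubled_box_def cylinder_def dist_real_def)
  then show "\<bar>snd z - snd b\<bar> \<le> 3 * \<delta> powr \<alpha>" by linarith
qed

lemma compact_thickening:
  fixes K :: "'b::euclidean_space set"
  assumes "compact K"
  shows "compact (\<Union>x\<in>K. cball x e)"
proof -
  have "(\<Union>x\<in>K. cball x e) = {x + y | x y. x \<in> K \<and> y \<in> cball 0 e}"
  proof safe
    fix x y assume "x \<in> K" "y \<in> cball x e"
    then show "\<exists>x' z. y = x' + z \<and> x' \<in> K \<and> z \<in> cball 0 e"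
      by (intro exI[of _ x] exI[of _ "y - x"]) (auto simp: dist_norm norm_minus_commute)
  next
    fix x y :: 'b assume "x \<in> K" "y \<in> cball 0 e"
    then show "x + y \<in> (\<Union>x\<in>K. cball x e)" by (auto simp: dist_norm intro!: bexI[of _ x])
  qed
  also have "compact \<dots>" by (intro compact_sums assms compact_cball)
  finally show ?thesis .
qed

text \<open>
  The closure of \<open>B\<close> is projected to space and to time and each projection is thickened separately: local
  norms are finite on products of compact sets.
\<close>

lemma emeasure_eq_0_interior:
  fixes \<Omega> :: "'a::euclidean_space set" and u :: "'a \<times> real \<Rightarrow> 'a" and p :: "'a \<times> real \<Rightarrow> real"
  assumes \<Omega>: "open \<Omega>" and \<mu>: "anomalous_dissipation \<Omega> T u p \<mu>"
    and u: "in_LL_loc q r {0<..<T} \<Omega> u" and p: "in_LL_loc (q / 2) (r / 2) {0<..<T} \<Omega> p"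
    and rq: "3 \<le> r" "3 \<le> q" and \<alpha>: "0 < \<alpha>" and s: "s = crit_exponent DIM('a) \<alpha> q r"
    and B: "compactly_in B (\<Omega> \<times> {0<..<T})"
    and H: "q < \<infinity> \<and> hausdorff_aniso \<alpha> s B < \<infinity> \<or> hausdorff_aniso \<alpha> s B = 0"
  shows "emeasure \<mu> B = 0"
proof -
  let ?X = "\<Omega> \<times> {0<..<T}"
  have "compact (closure B) \<and> closure B \<subseteq> ?X" using B by (simp only: compactly_in_def)
  then have cB: "compact (closure B)" "closure B \<subseteq> ?X" by (rule conjunct1, rule conjunct2)
  have BX: "B \<subseteq> ?X" by (rule order_trans[OF closure_subset cB(2)])
  define K1 where "K1 = fst ` closure B"
  define J1 where "J1 = snd ` closure B"
  have K1: "compact K1" unfolding K1_def by (intro compact_continuous_image continuous_intros cB)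
  have J1: "compact J1" unfolding J1_def by (intro compact_continuous_image continuous_intros cB)
  have K1\<Omega>: "K1 \<subseteq> \<Omega>" unfolding K1_def by (rule image_subsetI) (use cB(2) in force)
  have J1T: "J1 \<subseteq> {0<..<T}" unfolding J1_def by (rule image_subsetI) (use cB(2) in force)
  obtain e1 where e1: "0 < e1" "(\<Union>x\<in>K1. cball x e1) \<subseteq> \<Omega>"
    by (rule compact_subset_open_imp_cball_epsilon_subset[OF K1 \<Omega> K1\<Omega>])
  obtain e2 where e2: "0 < e2" "(\<Union>t\<in>J1. cball t e2) \<subseteq> {0<..<T}"
    by (rule compact_subset_open_imp_cball_epsilon_subset[OF J1 open_greaterThanLessThan J1T])
  define W where "W = (\<Union>x\<in>K1. cball x e1)"
  define J where "J = (\<Union>t\<in>J1. cball t e2)"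
  have WJ: "compact W" "compact J" "W \<subseteq> \<Omega>" "J \<subseteq> {0<..<T}"
    unfolding W_def J_def by (rule compact_thickening[OF K1] compact_thickening[OF J1] e1 e2)+
  obtain \<delta>\<^sub>0 where \<delta>\<^sub>0: "0 < \<delta>\<^sub>0" "\<And>\<delta>. 0 < \<delta> \<Longrightarrow> \<delta> < \<delta>\<^sub>0 \<Longrightarrow> \<delta> < min e1 e2 / 3 \<and> \<delta> powr \<alpha> < min e1 e2 / 3"
    using obtain_radius_with_small_powr[OF \<alpha>, of "min e1 e2 / 3"] e1(1) e2(1) by auto
  have box: "doubled_box \<delta> (\<delta> powr \<alpha>) c \<subseteq> W \<times> J"
    if \<delta>: "0 < \<delta>" "\<delta> < \<delta>\<^sub>0" and ne: "cylinder \<alpha> \<delta> c \<inter> B \<noteq> {}" for c :: "'a \<times> real" and \<delta>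
  proof
    fix z assume z: "z \<in> doubled_box \<delta> (\<delta> powr \<alpha>) c"
    obtain b where b: "b \<in> cylinder \<alpha> \<delta> c" "b \<in> B" using ne by blast
    then have "b \<in> closure B" using closure_subset[of B] by blast
    then have "fst b \<in> K1" "snd b \<in> J1" unfolding K1_def J1_def by (rule imageI)+
    moreover have "fst z \<in> cball (fst b) e1" "snd z \<in> cball (snd b) e2"
      using doubled_box_near_cylinder_point[OF z b(1)] \<delta>\<^sub>0(2)[OF \<delta>] unfolding mem_cball dist_real_def by linarith+
    ultimately show "z \<in> W \<times> J" by (auto simp: W_def J_def mem_Times_iff)
  qed
  show ?thesis
  proof (rule emeasure_eq_0_if_hausdorff_aniso[where X = ?X and W = W and J = J, OF _ _ _ _ _ _ _ rq \<alpha> s BX \<delta>\<^sub>0(1) _ _ H])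
    show "?X \<in> sets borel" using \<Omega> by (intro borel_open open_Times) auto
    show "radon_measure_on ?X \<mu>" "energy_balance \<Omega> T u p ?X \<mu>"
      using \<mu> by (auto simp: anomalous_dissipation_def)
    show "W \<in> sets borel" "J \<in> sets borel" using WJ by (auto intro: borel_compact)
    show "in_LL q r J W u" "in_LL (q / 2) (r / 2) J W p"
      using u p WJ by (auto simp: in_LL_loc_def)
    fix c :: "'a \<times> real" and \<delta> assume "0 < \<delta>" "\<delta> < \<delta>\<^sub>0" "cylinder \<alpha> \<delta> c \<inter> B \<noteq> {}"
    note bx = box[OF this]
    then show "doubled_box \<delta> (\<delta> powr \<alpha>) c \<inter> ?X \<subseteq> W \<times> J" by blast
    show "compactly_in (doubled_box \<delta> (\<delta> powr \<alpha>) c \<inter> ?X) ?X"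
      using bx WJ by (intro compactly_in_subset_compact[where C = "W \<times> J"] compact_Times) auto
  qed
qed

text \<open>
  With \<open>e > 0\<close> the least time in the closure of \<open>B\<close>, boxes around cylinders that meet
  \<open>B\<close> and have time scale below \<open>e/6\<close> stay at times above \<open>e/2\<close>.  Boundedness of \<open>\<Omega>\<close> makes
  the remaining part of the space compact.
\<close>

lemma emeasure_eq_0_up_to_boundary:
  fixes \<Omega> :: "'a::euclidean_space set" and u :: "'a \<times> real \<Rightarrow> 'a" and p :: "'a \<times> real \<Rightarrow> real"
  assumes \<Omega>: "open \<Omega>" and \<mu>: "boundary_extendable_dissipation \<Omega> T u p \<mu>"
    and u: "in_LL q r {0<..<T} \<Omega> u" and p: "in_LL (q / 2) (r / 2) {0<..<T} \<Omega> p"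
    and rq: "3 \<le> r" "3 \<le> q" and \<alpha>: "0 < \<alpha>" and s: "s = crit_exponent DIM('a) \<alpha> q r"
    and B: "compactly_in B (closure \<Omega> \<times> {0<..T})"
    and H: "q < \<infinity> \<and> hausdorff_aniso \<alpha> s B < \<infinity> \<or> hausdorff_aniso \<alpha> s B = 0"
  shows "emeasure \<mu> B = 0"
proof (cases "B = {}")
  case False
  let ?X = "closure \<Omega> \<times> {0<..T}"
  have "compact (closure B) \<and> closure B \<subseteq> ?X" using B by (simp only: compactly_in_def)
  then have cB: "compact (closure B)" "closure B \<subseteq> ?X" by (rule conjunct1, rule conjunct2)
  have BX: "B \<subseteq> ?X" by (rule order_trans[OF closure_subset cB(2)])
  have "compact (snd ` closure B)"
    by (intro compact_continuous_image continuous_intros cB)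
  moreover have "snd ` closure B \<noteq> {}" using False by simp
  ultimately obtain e where e: "e \<in> snd ` closure B" "\<And>t. t \<in> snd ` closure B \<Longrightarrow> e \<le> t"
    using compact_attains_inf[of "snd ` closure B"] by blast
  have "0 < e" using e(1) cB(2) by force
  then obtain \<delta>\<^sub>0 where \<delta>\<^sub>0: "0 < \<delta>\<^sub>0" "\<And>\<delta>. 0 < \<delta> \<Longrightarrow> \<delta> < \<delta>\<^sub>0 \<Longrightarrow> \<delta> < e / 6 \<and> \<delta> powr \<alpha> < e / 6"
    using obtain_radius_with_small_powr[OF \<alpha>, of "e / 6"] by auto
  show ?thesis
  proof (rule emeasure_eq_0_if_hausdorff_aniso[where X = ?X and W = \<Omega> and J = "{0<..<T}",
        OF _ _ _ _ _ u p rq \<alpha> s BX \<delta>\<^sub>0(1) _ _ H])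
    show "?X \<in> sets borel" by (intro borel_Times) auto
    show "radon_measure_on ?X \<mu>" "energy_balance \<Omega> T u p ?X \<mu>"
      using \<mu> by (auto simp: boundary_extendable_dissipation_def)
    show "\<Omega> \<in> sets borel" "{0<..<T} \<in> sets borel" using \<Omega> by auto
    fix c :: "'a \<times> real" and \<delta> assume \<delta>: "0 < \<delta>" "\<delta> < \<delta>\<^sub>0" and ne: "cylinder \<alpha> \<delta> c \<inter> B \<noteq> {}"
    show "doubled_box \<delta> (\<delta> powr \<alpha>) c \<inter> \<Omega> \<times> {0<..<T} \<subseteq> \<Omega> \<times> {0<..<T}" by blast
    obtain b where b: "b \<in> cylinder \<alpha> \<delta> c" "b \<in> B" using ne by blast
    then have "b \<in> closure B" using closure_subset[of B] by blast
    then have "e \<le> snd b" by (intro e(2) imageI)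
    have "doubled_box \<delta> (\<delta> powr \<alpha>) c \<inter> ?X \<subseteq> closure \<Omega> \<times> {e / 2..T}"
    proof
      fix z assume z: "z \<in> doubled_box \<delta> (\<delta> powr \<alpha>) c \<inter> ?X"
      then have "\<bar>snd z - snd b\<bar> \<le> 3 * \<delta> powr \<alpha>" by (intro doubled_box_near_cylinder_point(2)[OF _ b(1)]) (rule IntD1)
      then have "e / 2 \<le> snd z" using \<delta>\<^sub>0(2)[OF \<delta>] \<open>e \<le> snd b\<close> by linarith
      with z show "z \<in> closure \<Omega> \<times> {e / 2..T}" by (auto simp: mem_Times_iff)
    qed
    moreover have "compact (closure \<Omega> \<times> {e / 2..T})"
      using \<mu> by (intro compact_Times) (auto simp: boundary_extendable_dissipation_def)
    moreover have "closure \<Omega> \<times> {e / 2..T} \<subseteq> ?X" using \<open>0 < e\<close> by auto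
    ultimately show "compactly_in (doubled_box \<delta> (\<delta> powr \<alpha>) c \<inter> ?X) ?X" by (rule compactly_in_subset_compact)
  qed
qed simp

text \<open>
  Absolute continuity concerns all Borel sets, whereas the covering argument needs compactly contained ones.
\<close>

lemma null_set_by_compact_exhaustion:
  fixes X :: "('a::euclidean_space \<times> real) set"
  assumes sets: "sets \<mu> = sets (restrict_space borel X)" and X: "X \<in> sets borel"
    and C: "\<And>n::nat. compact (C n)" "X = (\<Union>n. C n)"
    and null: "\<And>B. B \<in> sets borel \<Longrightarrow> compactly_in B X \<Longrightarrow> hausdorff_aniso \<alpha> s B = 0 \<Longrightarrow> emeasure \<mu> B = 0"
    and A: "A \<in> sets \<mu>" "hausdorff_aniso \<alpha> s A = 0"
  shows "emeasure \<mu> A = 0"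
proof -
  have A': "A \<in> sets borel" "A \<subseteq> X" using A(1) X by (auto simp: sets sets_restrict_space_iff)
  have An: "A \<inter> C n \<in> sets borel" for n using A' C by (auto intro: borel_compact)
  have "emeasure \<mu> (A \<inter> C n) = 0" for n
  proof (rule null)
    show "A \<inter> C n \<in> sets borel" by (rule An)
    show "compactly_in (A \<inter> C n) X"
      using C by (intro compactly_in_subset_compact[where C = "C n"]) auto
    show "hausdorff_aniso \<alpha> s (A \<inter> C n) = 0"
      using hausdorff_aniso_mono[of "A \<inter> C n" A \<alpha> s] A(2) by simp
  qed
  then have "emeasure \<mu> (\<Union>n. A \<inter> C n) = 0"
    using An A' X by (intro emeasure_UN_eq_0) (auto simp: sets sets_restrict_space_iff)
  moreover have "(\<Union>n. A \<inter> C n) = A" using A' C by blast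
  ultimately show ?thesis by simp
qed

theorem theorem3p1:
  fixes \<Omega> :: "'a::euclidean_space set" and T \<alpha> s :: real and r q :: ennreal
    and u :: "'a \<times> real \<Rightarrow> 'a" and p :: "'a \<times> real \<Rightarrow> real"
  assumes "DIM('a) \<ge> 2" and "open \<Omega>" and "connected \<Omega>" and "\<Omega> \<noteq> {}" and "T > 0"
    and "\<alpha> > 0" and "3 \<le> r" and "3 \<le> q"
    and "s = crit_exponent DIM('a) \<alpha> q r" and "s \<ge> 0"
    and "in_LL_loc q r {0<..<T} \<Omega> u" and "in_LL_loc (q / 2) (r / 2) {0<..<T} \<Omega> p"
    and "weak_euler \<Omega> T u p"
  shows
    "(\<forall>\<epsilon>. anomalous_dissipation \<Omega> T u p \<epsilon> \<longrightarrow>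
        (q < \<infinity> \<longrightarrow>
           (\<forall>B\<in>sets borel. compactly_in B (\<Omega> \<times> {0<..<T}) \<longrightarrow>
              hausdorff_aniso \<alpha> s B < \<infinity> \<longrightarrow> emeasure \<epsilon> B = 0)) \<and>
        (q = \<infinity> \<longrightarrow> abs_cont_hausdorff \<epsilon> \<alpha> s) \<and>
        (\<forall>S\<in>sets borel. emeasure \<epsilon> (space \<epsilon>) \<noteq> 0 \<longrightarrow> concentrated_on \<epsilon> S \<longrightarrow>
           dim_aniso \<alpha> S \<ge> ereal s)) \<and>
     (bounded \<Omega> \<and> in_LL q r {0<..<T} \<Omega> u \<and> in_LL (q / 2) (r / 2) {0<..<T} \<Omega> p \<longrightarrow>
      (\<forall>\<epsilon>'. boundary_extendable_dissipation \<Omega> T u p \<epsilon>' \<longrightarrow>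
        (q < \<infinity> \<longrightarrow>
           (\<forall>B\<in>sets borel. compactly_in B (closure \<Omega> \<times> {0<..T}) \<longrightarrow>
              hausdorff_aniso \<alpha> s B < \<infinity> \<longrightarrow> emeasure \<epsilon>' B = 0)) \<and>
        (q = \<infinity> \<longrightarrow> abs_cont_hausdorff \<epsilon>' \<alpha> s)))"
proof (intro conjI allI impI)
  let ?X = "\<Omega> \<times> {0<..<T}"
  fix \<epsilon> assume \<epsilon>: "anomalous_dissipation \<Omega> T u p \<epsilon>"
  note null = emeasure_eq_0_interior[OF assms(2) \<epsilon> assms(11,12,7,8,6,9)]
  have sets: "sets \<epsilon> = sets (restrict_space borel ?X)"
    using \<epsilon> by (simp add: anomalous_dissipation_def radon_measure_on_def)
  have opn: "open ?X" using assms(2) by (intro open_Times) auto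
  have exh: "emeasure \<epsilon> A = 0" if A: "A \<in> sets \<epsilon>" "hausdorff_aniso \<alpha> s A = 0" for A
  proof -
    obtain C where C: "\<And>n::nat. compact (C n)" "(\<Union>n. C n) = ?X"
      using open_Union_compact_subsets[OF opn] by metis
    show ?thesis
      by (rule null_set_by_compact_exhaustion[OF sets _ C(1) C(2)[symmetric] _ A])
        (use opn null in auto)
  qed
  show "\<forall>B\<in>sets borel. compactly_in B ?X \<longrightarrow> hausdorff_aniso \<alpha> s B < \<infinity> \<longrightarrow> emeasure \<epsilon> B = 0" if "q < \<infinity>"
    using that null by blast
  show "abs_cont_hausdorff \<epsilon> \<alpha> s" if "q = \<infinity>"
    using exh by (auto simp: abs_cont_hausdorff_def)
  show "\<forall>S\<in>sets borel. emeasure \<epsilon> (space \<epsilon>) \<noteq> 0 \<longrightarrow> concentrated_on \<epsilon> S \<longrightarrow> dim_aniso \<alpha> S \<ge> ereal s"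
  proof (intro ballI impI)
    fix S :: "('a \<times> real) set"
    assume S: "S \<in> sets borel" and ne: "emeasure \<epsilon> (space \<epsilon>) \<noteq> 0" and conc: "concentrated_on \<epsilon> S"
    have space: "space \<epsilon> = ?X" by (simp add: sets_eq_imp_space_eq[OF sets] space_restrict_space)
    show "dim_aniso \<alpha> S \<ge> ereal s"
      unfolding dim_aniso_def
    proof (rule INF_greatest)
      fix s' assume s': "s' \<in> {s. 0 \<le> s \<and> hausdorff_aniso \<alpha> s S = 0}"
      have "s \<le> s'"
      proof (rule ccontr)
        assume "\<not> s \<le> s'"
        then have "hausdorff_aniso \<alpha> s S = 0"
          using hausdorff_aniso_antimono_exponent[of s' s \<alpha> S] s' by simp
        then have "hausdorff_aniso \<alpha> s (?X \<inter> S) = 0"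
          using hausdorff_aniso_mono[of "?X \<inter> S" S \<alpha> s] by simp
        moreover have "?X \<inter> S \<in> sets \<epsilon>"
          unfolding sets using S opn by (subst sets_restrict_space_iff) auto
        ultimately have "emeasure \<epsilon> (?X \<inter> S) = 0" using exh by blast
        then show False using conc ne space by (metis concentrated_on_def sets.top)
      qed
      then show "ereal s \<le> ereal s'" by simp
    qed
  qed
next
  let ?X = "closure \<Omega> \<times> {0<..T}"
  fix \<epsilon>' assume glob: "bounded \<Omega> \<and> in_LL q r {0<..<T} \<Omega> u \<and> in_LL (q / 2) (r / 2) {0<..<T} \<Omega> p"
    and \<epsilon>': "boundary_extendable_dissipation \<Omega> T u p \<epsilon>'"
  have u: "in_LL q r {0<..<T} \<Omega> u" and p: "in_LL (q / 2) (r / 2) {0<..<T} \<Omega> p"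
    using glob by blast+
  note null = emeasure_eq_0_up_to_boundary[OF assms(2) \<epsilon>' u p assms(7,8,6,9)]
  have sets: "sets \<epsilon>' = sets (restrict_space borel ?X)"
    using \<epsilon>' by (simp add: boundary_extendable_dissipation_def radon_measure_on_def)
  have XU: "?X = (\<Union>n. closure \<Omega> \<times> {1 / real (Suc n)..T})"
  proof -
    have "\<exists>n. 1 / real (Suc n) \<le> t" if "0 < t" for t
      using reals_Archimedean[OF that] by (metis inverse_eq_divide less_imp_le)
    moreover have "0 < t" if "1 / real (Suc n) \<le> t" for t n
      using that by (rule less_le_trans[rotated]) simp
    ultimately show ?thesis by fastforce
  qed
  show "\<forall>B\<in>sets borel. compactly_in B ?X \<longrightarrow> hausdorff_aniso \<alpha> s B < \<infinity> \<longrightarrow> emeasure \<epsilon>' B = 0" if "q < \<infinity>"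
    using that null by blast
  show "abs_cont_hausdorff \<epsilon>' \<alpha> s" if "q = \<infinity>"
    unfolding abs_cont_hausdorff_def
  proof (intro ballI impI)
    fix A assume A: "A \<in> sets \<epsilon>'" "hausdorff_aniso \<alpha> s A = 0"
    show "emeasure \<epsilon>' A = 0"
    proof (rule null_set_by_compact_exhaustion[OF sets _ _ XU _ A])
      show "?X \<in> sets borel" by (intro borel_Times) auto
      show "compact (closure \<Omega> \<times> {1 / real (Suc n)..T})" for n
        using glob by (intro compact_Times) auto
    qed (use null in blast)
  qed
qed

end
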